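(* Let the ground field be $\mathbb{C}$ and let $n>2$. For every nonnegative integer $t$, the dimension of any irreducible $n$-Lie $V_n$-module with ($n$-Lie) highest weight $t$ is equal to $$\frac{n+2t-1}{n+t-1}\binom{n+t-1}{t}.$$
   Context: **$n$-Lie algebras.** An $n$-Lie algebra is a vector space $A$ with a skew-symmetric multilinear map $[\cdot,\ldots,\cdot]:\wedge^nA\to A$ satisfying, for all $a_1,\ldots,a_{2n-1}\in A$, $$[a_1,\ldots,a_{n-1},[a_n,\ldots,a_{2n-1}]]=\sum_{i=n}^{2n-1}[a_n,\ldots,a_{i-1},[a_1,\ldots,a_{n-1},a_i],a_{i+1},\ldots,a_{2n-1}].$$ **Basic Lie algebra.** $L(A)=\wedge^{n-1}A$ with bracket $$[a_1\wedge\cdots\wedge a_{n-1},\,b_1\wedge\cdots\wedge b_{n-1}]=\sum_{i=1}^{n-1}b_1\wedge\cdots\wedge b_{i-1}\wedge[a_1,\ldots,a_{n-1},b_i]\wedge b_{i+1}\wedge\cdots\wedge b_{n-1}.$$ **$n$-Lie modules.** An $n$-Lie module over $A$ is a vector space $M$ with a linear map $\rho:\wedge^{n-1}A\to \mathrm{End}\,M$ which is a representation of $L(A)$, i.e. $\rho([x,y])=\rho(x)\rho(y)-\rho(y)\rho(x)$, and which satisfies, for all $a_1,\ldots,a_{2n-2}\in A$, $$\rho([a_1,\ldots,a_n]\wedge a_{n+1}\wedge\cdots\wedge a_{2n-2})=\sum_{i=1}^n(-1)^{i+n}\rho(a_1\wedge\cdots\wedge\widehat{a_i}\wedge\cdots\wedge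 a_n)\,\rho(a_i\wedge a_{n+1}\wedge\cdots\wedge a_{2n-2}).$$ It is irreducible if its only $\rho$-invariant subspaces are $0$ and itself. **Vector products $n$-Lie algebra.** $V_n$ is the $(n+1)$-dimensional complex $n$-Lie algebra with basis $e_1,\ldots,e_{n+1}$ and $[e_1,\ldots,\widehat{e_i},\ldots,e_{n+1}]=(-1)^ie_i$ for $i=1,\ldots,n+1$. **Identification $L(V_n)\cong so_{n+1}$.** $so_{n+1}$ has basis $e_{ij}=x_i\partial_j-x_j\partial_i$, $1\le i<j\le n+1$, acting on $\mathbb{C}[x_1,\ldots,x_{n+1}]$. The isomorphism is $e_1\wedge\cdots\widehat{e_i}\cdots\widehat{e_j}\cdots\wedge e_{n+1}\mapsto(-1)^{i+j+n+1}e_{ij}$ for $i<j$. **$n$-Lie highest weight.** A finite-dimensional irreducible $n$-Lie $V_n$-module has $n$-Lie highest weight $t$ if, as a module over $so_{n+1}\cong L(V_n)$, it is the following. For $n>3$, it is the irreducible module with highest weight $t\pi_1$, where $\pi_1$ is the first fundamental weight, i.e. the highest weight of the standard $(n+1)$-dimensional representation. For $n=3$, it is the module $M_t\otimes M_t$ over $so_4\cong sl_2\oplus sl_2$, with the first copy of $sl_2$ acting on the first factor and the second copy on the second factor, where $M_t$ is the $(t+1)$-dimensional irreducible $sl_2$-module. *)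

theory Defs
  imports Complex_Main "HOL-Library.Function_Algebras" "Jordan_Normal_Form.Matrix"
begin

section \<open>n-Lie algebras and their modules\<close>

text \<open>
  Linear maps out of the k-th exterior power of a vector space are represented, by the universal
  property, as alternating multilinear functions of lists of length k; their values on lists of
  any other length are irrelevant. The list \<open>[a\<^sub>1, \<dots>, a\<^sub>k]\<close> stands for the decomposable
  element \<open>a\<^sub>1 \<and> \<dots> \<and> a\<^sub>k\<close>. As decomposables span the exterior power, a
  (bi)linear identity on it holds as soon as it holds for decomposable arguments.
\<close>

definition alternating_multilinear ::
  "nat \<Rightarrow> ('k::field \<Rightarrow> 'a::ab_group_add \<Rightarrow> 'a) \<Rightarrow> ('k \<Rightarrow> 'b::ab_group_add \<Rightarrow> 'b) \<Rightarrow> ('a list \<Rightarrow> 'b) \<Rightarrow> bool"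
  where
  "alternating_multilinear k sA sB f \<longleftrightarrow>
     (\<forall>as i x y. length as = k \<and> i < k \<longrightarrow> f (as[i := x + y]) = f (as[i := x]) + f (as[i := y])) \<and>
     (\<forall>as i c x. length as = k \<and> i < k \<longrightarrow> f (as[i := sA c x]) = sB c (f (as[i := x]))) \<and>
     (\<forall>as. length as = k \<and> \<not> distinct as \<longrightarrow> f as = 0)"

definition omit :: "nat \<Rightarrow> 'a list \<Rightarrow> 'a list" where
  "omit i as = take i as @ drop (Suc i) as"

locale n_lie_algebra = vector_space scale
  for scale :: "'k::field \<Rightarrow> 'a::ab_group_add \<Rightarrow> 'a" +
  fixes n :: nat and br :: "'a list \<Rightarrow> 'a"
  assumes br_alternating: "alternating_multilinear n scale scale br"
    and br_fundamental_identity: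
      "length as = n - 1 \<Longrightarrow> length bs = n \<Longrightarrow>
         br (as @ [br bs]) = (\<Sum>i<n. br (bs[i := br (as @ [bs ! i])]))"

text \<open>
  In \<open>rho_bracket\<close> the left-hand side is the value of \<open>\<rho>\<close> on the bracket of \<open>as\<close> and
  \<open>bs\<close> in the basic Lie algebra. In \<open>rho_wedge_bracket\<close> the index \<open>i\<close> starts at 0, so
  that the sign \<open>(-1)^(i+n)\<close> of the usual 1-based formula becomes \<open>(-1)^(Suc i + n)\<close>.
\<close>

locale n_lie_module =
  A: n_lie_algebra scaleA n br + M: vector_space scaleM
  for scaleA :: "'k::field \<Rightarrow> 'a::ab_group_add \<Rightarrow> 'a"
    and n :: nat and br :: "'a list \<Rightarrow> 'a"
    and scaleM :: "'k \<Rightarrow> 'm::ab_group_add \<Rightarrow> 'm" +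
  fixes \<rho> :: "'a list \<Rightarrow> 'm \<Rightarrow> 'm"
  assumes rho_linear:
      "length as = n - 1 \<Longrightarrow> Vector_Spaces.linear scaleM scaleM (\<rho> as)"
    and rho_alternating:
      "alternating_multilinear (n - 1) scaleA scaleM (\<lambda>as. \<rho> as m)"
    and rho_bracket:
      "length as = n - 1 \<Longrightarrow> length bs = n - 1 \<Longrightarrow>
         (\<Sum>i<n - 1. \<rho> (bs[i := br (as @ [bs ! i])]) m) = \<rho> as (\<rho> bs m) - \<rho> bs (\<rho> as m)"
    and rho_wedge_bracket:
      "length as = n \<Longrightarrow> length bs = n - 2 \<Longrightarrow>
         \<rho> (br as # bs) m
           = (\<Sum>i<n. scaleM ((-1) ^ (Suc i + n)) (\<rho> (omit i as) (\<rho> ((as ! i) # bs) m)))"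

locale irreducible_n_lie_module = n_lie_module +
  assumes irreducible:
    "M.subspace W \<Longrightarrow> (\<And>as m. length as = n - 1 \<Longrightarrow> m \<in> W \<Longrightarrow> \<rho> as m \<in> W) \<Longrightarrow>
       W = {0} \<or> W = UNIV"

text \<open>The vector products n-Lie algebra, with its basis \<open>e 1, \<dots>, e (n + 1)\<close>.\<close>

locale vector_products_n_lie_algebra = n_lie_algebra scale n br
  for scale :: "complex \<Rightarrow> 'a::ab_group_add \<Rightarrow> 'a" and n :: nat and br :: "'a list \<Rightarrow> 'a" +
  fixes e :: "nat \<Rightarrow> 'a"
  assumes e_inj: "inj_on e {1..n + 1}"
    and e_independent: "independent (e ` {1..n + 1})"
    and e_span: "span (e ` {1..n + 1}) = UNIV"
    and br_e: "i \<in> {1..n + 1} \<Longrightarrow>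
       br (map e (filter (\<lambda>k. k \<noteq> i) [1..<n + 2])) = scale ((-1) ^ i) (e i)"


section \<open>Representations of complex matrix Lie algebras\<close>

definition commutator :: "complex mat \<Rightarrow> complex mat \<Rightarrow> complex mat" where
  "commutator X Y = X * Y - Y * X"

text \<open>
  The representation space is a subspace \<open>V\<close> of a vector space type, because the dimension of
  the modules below depends on a natural number.
\<close>

definition lie_representation ::
  "complex mat set \<Rightarrow> (complex \<Rightarrow> 'v::ab_group_add \<Rightarrow> 'v) \<Rightarrow> 'v set \<Rightarrow> (complex mat \<Rightarrow> 'v \<Rightarrow> 'v) \<Rightarrow> bool"
  where
  "lie_representation \<gg> s V \<pi> \<longleftrightarrow>
     vector_space s \<and> module.subspace s V \<and>
     (\<forall>X\<in>\<gg>. \<forall>v\<in>V. \<pi> X v \<in> V) \<and>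
     (\<forall>X\<in>\<gg>. \<forall>v\<in>V. \<forall>w\<in>V. \<pi> X (v + w) = \<pi> X v + \<pi> X w) \<and>
     (\<forall>X\<in>\<gg>. \<forall>c. \<forall>v\<in>V. \<pi> X (s c v) = s c (\<pi> X v)) \<and>
     (\<forall>X\<in>\<gg>. \<forall>Y\<in>\<gg>. \<forall>v\<in>V. \<pi> (X + Y) v = \<pi> X v + \<pi> Y v) \<and>
     (\<forall>X\<in>\<gg>. \<forall>c. \<forall>v\<in>V. \<pi> (c \<cdot>\<^sub>m X) v = s c (\<pi> X v)) \<and>
     (\<forall>X\<in>\<gg>. \<forall>Y\<in>\<gg>. \<forall>v\<in>V. \<pi> (commutator X Y) v = \<pi> X (\<pi> Y v) - \<pi> Y (\<pi> X v))"

definition irreducible_lie_representation ::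
  "complex mat set \<Rightarrow> (complex \<Rightarrow> 'v::ab_group_add \<Rightarrow> 'v) \<Rightarrow> 'v set \<Rightarrow> (complex mat \<Rightarrow> 'v \<Rightarrow> 'v) \<Rightarrow> bool"
  where
  "irreducible_lie_representation \<gg> s V \<pi> \<longleftrightarrow>
     lie_representation \<gg> s V \<pi> \<and> V \<noteq> {0} \<and>
     (\<forall>W. module.subspace s W \<and> W \<subseteq> V \<and> (\<forall>X\<in>\<gg>. \<forall>w\<in>W. \<pi> X w \<in> W) \<longrightarrow> W = {0} \<or> W = V)"


section \<open>The orthogonal Lie algebra and its highest weights\<close>

definition so :: "nat \<Rightarrow> complex mat set" where
  "so N = {X \<in> carrier_mat N N. transpose_mat X = - X}"

text \<open>
  The linear vector field \<open>x\<^sub>i \<partial>\<^sub>j\<close> is identified with the matrix unit \<open>E\<^sub>i\<^sub>j\<close>; this preserves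
  commutators, and is the action on linear forms. So \<open>so_basis N i j\<close> is
  \<open>e\<^sub>i\<^sub>j = x\<^sub>i \<partial>\<^sub>j - x\<^sub>j \<partial>\<^sub>i\<close>. The indices \<open>i, j\<close> are 1-based; matrix entries are 0-based.
\<close>

definition so_basis :: "nat \<Rightarrow> nat \<Rightarrow> nat \<Rightarrow> complex mat" where
  "so_basis N i j = mat N N (\<lambda>(r, c).
     if Suc r = i \<and> Suc c = j then 1 else if Suc r = j \<and> Suc c = i then - 1 else 0)"

text \<open>
  The Cartan subalgebra of \<open>so N\<close> is spanned by \<open>so_cartan N k\<close>, \<open>1 \<le> k \<le> N div 2\<close>.
  A weight \<open>\<mu>\<close> is given by its values \<open>\<mu> k\<close> on these elements, i.e. by its coordinates with
  respect to the dual basis \<open>\<epsilon> 1, \<epsilon> 2, \<dots>\<close>. The factor \<open>-\<i>\<close> makes the roots real.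
\<close>

definition so_cartan :: "nat \<Rightarrow> nat \<Rightarrow> complex mat" where
  "so_cartan N k = (- \<i>) \<cdot>\<^sub>m so_basis N (2 * k - 1) (2 * k)"

definition \<epsilon> :: "nat \<Rightarrow> nat \<Rightarrow> complex" where
  "\<epsilon> i k = (if k = i then 1 else 0)"

definition so_positive_roots :: "nat \<Rightarrow> (nat \<Rightarrow> complex) set" where
  "so_positive_roots N =
     {\<alpha>. \<exists>i j. 1 \<le> i \<and> i < j \<and> j \<le> N div 2 \<and>
           (\<alpha> = (\<lambda>k. \<epsilon> i k - \<epsilon> j k) \<or> \<alpha> = (\<lambda>k. \<epsilon> i k + \<epsilon> j k))} \<union>
     {\<alpha>. odd N \<and> (\<exists>i. 1 \<le> i \<and> i \<le> N div 2 \<and> \<alpha> = \<epsilon> i)}"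

definition so_root_space :: "nat \<Rightarrow> (nat \<Rightarrow> complex) \<Rightarrow> complex mat set" where
  "so_root_space N \<alpha> =
     {X \<in> so N. \<forall>k\<in>{1..N div 2}. commutator (so_cartan N k) X = \<alpha> k \<cdot>\<^sub>m X}"

text \<open>
  The zero vector is a parameter so that the definition also applies to the standard
  representation on \<open>complex vec\<close>, which is not an instance of \<open>zero\<close>.
\<close>

definition so_highest_weight_vector ::
  "nat \<Rightarrow> 'v \<Rightarrow> (complex \<Rightarrow> 'v \<Rightarrow> 'v) \<Rightarrow> (complex mat \<Rightarrow> 'v \<Rightarrow> 'v) \<Rightarrow> (nat \<Rightarrow> complex) \<Rightarrow> 'v \<Rightarrow> bool"
  where
  "so_highest_weight_vector N z s \<pi> \<mu> v \<longleftrightarrow>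
     v \<noteq> z \<and>
     (\<forall>k\<in>{1..N div 2}. \<pi> (so_cartan N k) v = s (\<mu> k) v) \<and>
     (\<forall>\<alpha>\<in>so_positive_roots N. \<forall>X\<in>so_root_space N \<alpha>. \<pi> X v = z)"

definition so_first_fundamental_weight :: "nat \<Rightarrow> complex" where
  "so_first_fundamental_weight = \<epsilon> 1"

definition so_irreducible_highest_weight_module ::
  "nat \<Rightarrow> (complex \<Rightarrow> 'm::ab_group_add \<Rightarrow> 'm) \<Rightarrow> (complex mat \<Rightarrow> 'm \<Rightarrow> 'm) \<Rightarrow> (nat \<Rightarrow> complex) \<Rightarrow> bool"
  where
  "so_irreducible_highest_weight_module N s \<sigma> \<mu> \<longleftrightarrow>
     irreducible_lie_representation (so N) s UNIV \<sigma> \<and>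
     (\<exists>v. so_highest_weight_vector N 0 s \<sigma> \<mu> v)"


subsection \<open>The first fundamental weight is the highest weight of the standard representation\<close>

lemma so_basis_carrier [simp]: "so_basis N i j \<in> carrier_mat N N"
  by (simp add: so_basis_def)

lemma so_cartan_carrier [simp]: "so_cartan N k \<in> carrier_mat N N"
  by (simp add: so_cartan_def)

lemma so_cartan_mult_vec:
  assumes v: "v \<in> carrier_vec N" and k: "1 \<le> k" "k \<le> N div 2" and r: "r < N"
  shows "(so_cartan N k *\<^sub>v v) $ r =
    (if r = 2 * k - 2 then - \<i> * v $ (2 * k - 1)
     else if r = 2 * k - 1 then \<i> * v $ (2 * k - 2) else 0)"
proof -
  have dims: "2 * k - 2 < N" "2 * k - 1 < N" using k by auto
  have "(so_cartan N k *\<^sub>v v) $ r = (\<Sum>c<N. so_cartan N k $$ (r, c) * v $ c)"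
    using v r by (simp add: scalar_prod_def lessThan_atLeast0 so_cartan_def so_basis_def)
  also have "\<dots> = (\<Sum>c<N. (if c = 2 * k - 1 then (if r = 2 * k - 2 then - \<i> * v $ c else 0) else 0)
      + (if c = 2 * k - 2 then (if r = 2 * k - 1 then \<i> * v $ c else 0) else 0))"
    using r k by (intro sum.cong refl) (auto simp: so_cartan_def so_basis_def)
  also have "\<dots> = (if r = 2 * k - 2 then - \<i> * v $ (2 * k - 1) else 0)
      + (if r = 2 * k - 1 then \<i> * v $ (2 * k - 2) else 0)"
    using dims by (simp add: sum.distrib)
  also have "\<dots> = (if r = 2 * k - 2 then - \<i> * v $ (2 * k - 1)
     else if r = 2 * k - 1 then \<i> * v $ (2 * k - 2) else 0)"
    using k by auto
  finally show ?thesis .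
qed

lemma so_first_fundamental_weight_standard:
  assumes N: "2 \<le> N"
  shows "so_highest_weight_vector N (0\<^sub>v N) (\<cdot>\<^sub>v) (*\<^sub>v) so_first_fundamental_weight
           (vec N (\<lambda>r. if r = 0 then 1 else if r = 1 then \<i> else 0))"
    (is "so_highest_weight_vector N _ _ _ _ ?v")
  unfolding so_highest_weight_vector_def
proof (intro conjI ballI)
  have v: "?v \<in> carrier_vec N" by simp
  show "?v \<noteq> 0\<^sub>v N"
  proof
    assume "?v = 0\<^sub>v N"
    then have "?v $ 0 = 0\<^sub>v N $ 0" by simp
    then show False using N by simp
  qed
  show weight: "so_cartan N k *\<^sub>v ?v = so_first_fundamental_weight k \<cdot>\<^sub>v ?v"
    if "k \<in> {1..N div 2}" for k
  proof (rule eq_vecI)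
    fix r assume "r < dim_vec (so_first_fundamental_weight k \<cdot>\<^sub>v ?v)"
    then have r: "r < N" by simp
    have d: "2 * k - 2 < N" "2 * k - 1 < N" "1 \<le> k" using that by auto
    have "(so_cartan N k *\<^sub>v ?v) $ r =
      (if r = 2 * k - 2 then - \<i> * ?v $ (2 * k - 1)
       else if r = 2 * k - 1 then \<i> * ?v $ (2 * k - 2) else 0)"
      by (rule so_cartan_mult_vec[OF v]) (use that r in auto)
    also have "\<dots> = so_first_fundamental_weight k * ?v $ r"
      using d r by (cases "k = 1") (auto simp: so_first_fundamental_weight_def \<epsilon>_def)
    finally show "(so_cartan N k *\<^sub>v ?v) $ r = (so_first_fundamental_weight k \<cdot>\<^sub>v ?v) $ r"
      using r by simp
  qed (simp add: so_cartan_def so_basis_def)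
  fix \<alpha> X assume \<alpha>: "\<alpha> \<in> so_positive_roots N" and X: "X \<in> so_root_space N \<alpha>"
  define w where "w = X *\<^sub>v ?v"
  have Xc: "X \<in> carrier_mat N N" using X by (simp add: so_root_space_def so_def)
  have w: "w \<in> carrier_vec N" using Xc by (simp add: w_def)
  have weight_w: "so_cartan N k *\<^sub>v w = (\<epsilon> 1 k + \<alpha> k) \<cdot>\<^sub>v w" if k: "k \<in> {1..N div 2}" for k
  proof -
    let ?H = "so_cartan N k"
    have "commutator ?H X = \<alpha> k \<cdot>\<^sub>m X" using X k by (simp add: so_root_space_def)
    then have "(?H * X - X * ?H) *\<^sub>v ?v = \<alpha> k \<cdot>\<^sub>v w"
      using Xc v unfolding commutator_def w_def
      by (auto intro!: eq_vecI)
    moreover have "(?H * X - X * ?H) *\<^sub>v ?v = ?H *\<^sub>v w - X *\<^sub>v (?H *\<^sub>v ?v)"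
      unfolding w_def
      using minus_mult_distrib_mat_vec[OF mult_carrier_mat[OF so_cartan_carrier Xc]
          mult_carrier_mat[OF Xc so_cartan_carrier] v]
        assoc_mult_mat_vec[OF so_cartan_carrier Xc v] assoc_mult_mat_vec[OF Xc so_cartan_carrier v]
      by simp
    moreover have "X *\<^sub>v (?H *\<^sub>v ?v) = \<epsilon> 1 k \<cdot>\<^sub>v w"
      using weight[OF k] Xc v unfolding w_def so_first_fundamental_weight_def
      by (simp add: mult_mat_vec[of _ N N])
    ultimately have eq: "?H *\<^sub>v w - \<epsilon> 1 k \<cdot>\<^sub>v w = \<alpha> k \<cdot>\<^sub>v w" by simp
    have Hw: "?H *\<^sub>v w \<in> carrier_vec N" using w by (intro mult_mat_vec_carrier[of _ N N]) auto
    show ?thesis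
    proof (rule eq_vecI)
      fix r assume "r < dim_vec ((\<epsilon> 1 k + \<alpha> k) \<cdot>\<^sub>v w)"
      then have r: "r < N" using w by auto
      have "(?H *\<^sub>v w - \<epsilon> 1 k \<cdot>\<^sub>v w) $ r = (\<alpha> k \<cdot>\<^sub>v w) $ r" by (simp only: eq)
      then have "(?H *\<^sub>v w) $ r - \<epsilon> 1 k * w $ r = \<alpha> k * w $ r"
        using r w Hw by (simp del: index_mult_mat_vec)
      then show "(?H *\<^sub>v w) $ r = ((\<epsilon> 1 k + \<alpha> k) \<cdot>\<^sub>v w) $ r"
        using r w Hw by (simp add: algebra_simps del: index_mult_mat_vec)
    qed (use w in \<open>auto simp: so_cartan_def so_basis_def\<close>)
  qed
  have comp: "(\<epsilon> 1 k + \<alpha> k) * w $ r =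
     (if r = 2 * k - 2 then - \<i> * w $ (2 * k - 1)
      else if r = 2 * k - 1 then \<i> * w $ (2 * k - 2) else 0)"
    if "1 \<le> k" "k \<le> N div 2" "r < N" for k r
  proof -
    have "(so_cartan N k *\<^sub>v w) $ r = ((\<epsilon> 1 k + \<alpha> k) \<cdot>\<^sub>v w) $ r"
      using weight_w[of k] that by simp
    then show ?thesis using so_cartan_mult_vec[OF w that] that w by simp
  qed
  obtain i where i: "1 \<le> i" "i \<le> N div 2" "\<alpha> i = 1" "i \<noteq> 1 \<longrightarrow> \<alpha> 1 = 0"
    using \<alpha> unfolding so_positive_roots_def \<epsilon>_def by auto
  have "w $ r = 0" if r: "r < N" for r
  proof (cases "i = 1")
    case True
    have two: "2 * w $ q = (if q = 0 then - \<i> * w $ 1 else if q = 1 then \<i> * w $ 0 else 0)"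
      if "q < N" for q
      using comp[OF i(1,2) that] True i(3) by (simp add: \<epsilon>_def)
    have a: "2 * w $ 0 = - \<i> * w $ 1" "2 * w $ 1 = \<i> * w $ 0"
      using two[of 0] two[of 1] N by auto
    have "4 * w $ 0 = 2 * (2 * w $ 0)" by simp
    also have "\<dots> = - \<i> * (2 * w $ 1)" unfolding a(1) by simp
    also have "\<dots> = w $ 0" unfolding a(2) by simp
    finally have "w $ 0 = 0" by simp
    then show ?thesis using two[OF r] a(2) by (auto split: if_splits)
  next
    case False
    have 1: "w $ r = (if r = 0 then - \<i> * w $ 1 else if r = 1 then \<i> * w $ 0 else 0)"
      using comp[of 1 r] r N False i by (simp add: \<epsilon>_def)
    have 2: "w $ r = (if r = 2 * i - 2 then - \<i> * w $ (2 * i - 1)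
        else if r = 2 * i - 1 then \<i> * w $ (2 * i - 2) else 0)"
      using comp[of i r] r False i by (simp add: \<epsilon>_def)
    show ?thesis
      using 1 2 False i(1) by (auto split: if_splits)
  qed
  then show "X *\<^sub>v ?v = 0\<^sub>v N" using w unfolding w_def[symmetric] by (intro eq_vecI) auto
qed


section \<open>The case of so(4)\<close>

definition sl2 :: "complex mat set" where
  "sl2 = {X \<in> carrier_mat 2 2. X $$ (0, 0) + X $$ (1, 1) = 0}"

text \<open>\<open>\<psi>\<close> is an isomorphism of Lie algebras from the direct sum of two copies of \<open>sl2\<close>.\<close>

definition sl2_sum_so4_isomorphism :: "(complex mat \<times> complex mat \<Rightarrow> complex mat) \<Rightarrow> bool" where
  "sl2_sum_so4_isomorphism \<psi> \<longleftrightarrow>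
     bij_betw \<psi> (sl2 \<times> sl2) (so 4) \<and>
     (\<forall>X\<in>sl2. \<forall>Y\<in>sl2. \<forall>X'\<in>sl2. \<forall>Y'\<in>sl2. \<psi> (X + X', Y + Y') = \<psi> (X, Y) + \<psi> (X', Y')) \<and>
     (\<forall>c. \<forall>X\<in>sl2. \<forall>Y\<in>sl2. \<psi> (c \<cdot>\<^sub>m X, c \<cdot>\<^sub>m Y) = c \<cdot>\<^sub>m \<psi> (X, Y)) \<and>
     (\<forall>X\<in>sl2. \<forall>Y\<in>sl2. \<forall>X'\<in>sl2. \<forall>Y'\<in>sl2.
        \<psi> (commutator X X', commutator Y Y') = commutator (\<psi> (X, Y)) (\<psi> (X', Y')))"

text \<open>\<open>\<tau>\<close> exhibits the whole space of \<open>sM\<close> as the tensor product of the subspaces \<open>P\<close> and \<open>Q\<close>.\<close>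

definition is_tensor_product ::
  "(complex \<Rightarrow> 'p::ab_group_add \<Rightarrow> 'p) \<Rightarrow> 'p set \<Rightarrow> (complex \<Rightarrow> 'q::ab_group_add \<Rightarrow> 'q) \<Rightarrow> 'q set \<Rightarrow>
   (complex \<Rightarrow> 'm::ab_group_add \<Rightarrow> 'm) \<Rightarrow> ('p \<Rightarrow> 'q \<Rightarrow> 'm) \<Rightarrow> bool"
  where
  "is_tensor_product sP P sQ Q sM \<tau> \<longleftrightarrow>
     (\<forall>p\<in>P. \<forall>p'\<in>P. \<forall>q\<in>Q. \<tau> (p + p') q = \<tau> p q + \<tau> p' q) \<and>
     (\<forall>p\<in>P. \<forall>q\<in>Q. \<forall>q'\<in>Q. \<tau> p (q + q') = \<tau> p q + \<tau> p q') \<and>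
     (\<forall>c. \<forall>p\<in>P. \<forall>q\<in>Q. \<tau> (sP c p) q = sM c (\<tau> p q) \<and> \<tau> p (sQ c q) = sM c (\<tau> p q)) \<and>
     (\<exists>B C. \<not> module.dependent sP B \<and> module.span sP B = P \<and>
            \<not> module.dependent sQ C \<and> module.span sQ C = Q \<and>
            inj_on (\<lambda>(b, c). \<tau> b c) (B \<times> C) \<and>
            \<not> module.dependent sM ((\<lambda>(b, c). \<tau> b c) ` (B \<times> C)) \<and>
            module.span sM ((\<lambda>(b, c). \<tau> b c) ` (B \<times> C)) = UNIV)"

definition fun_scale :: "complex \<Rightarrow> (nat \<Rightarrow> complex) \<Rightarrow> nat \<Rightarrow> complex" where
  "fun_scale c f = (\<lambda>i. c * f i)"

text \<open>
  The \<open>so 4\<close>-module \<open>\<sigma>\<close> is the external tensor product of two copies of the (t+1)-dimensional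
  irreducible \<open>sl2\<close>-module \<open>\<pi>\<close>, realised on a subspace \<open>P\<close> of \<open>nat \<Rightarrow> complex\<close>. The choice of
  the isomorphism \<open>\<psi>\<close> is immaterial: any two differ by inner automorphisms of the
  copies of \<open>sl2\<close> and possibly their exchange.
\<close>

definition so4_module_Mt_tensor_Mt ::
  "(complex \<Rightarrow> 'm::ab_group_add \<Rightarrow> 'm) \<Rightarrow> (complex mat \<Rightarrow> 'm \<Rightarrow> 'm) \<Rightarrow> nat \<Rightarrow> bool"
  where
  "so4_module_Mt_tensor_Mt s \<sigma> t \<longleftrightarrow>
     lie_representation (so 4) s UNIV \<sigma> \<and>
     (\<exists>\<psi> P \<pi> \<tau>. sl2_sum_so4_isomorphism \<psi> \<and>
        irreducible_lie_representation sl2 fun_scale P \<pi> \<and>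
        vector_space.dim fun_scale P = t + 1 \<and>
        is_tensor_product fun_scale P fun_scale P s \<tau> \<and>
        (\<forall>X\<in>sl2. \<forall>Y\<in>sl2. \<forall>p\<in>P. \<forall>q\<in>P.
           \<sigma> (\<psi> (X, Y)) (\<tau> p q) = \<tau> (\<pi> X p) q + \<tau> p (\<pi> Y q)))"


section \<open>n-Lie highest weights\<close>

text \<open>
  \<open>\<sigma>\<close> is the action of \<open>so (n + 1)\<close> that corresponds to \<open>\<rho>\<close> under the isomorphism sending
  \<open>e\<^sub>1 \<and> \<dots> \<and> e\<^sub>n\<^sub>+\<^sub>1\<close> with \<open>e\<^sub>i\<close> and \<open>e\<^sub>j\<close> omitted to \<open>(-1)^(i+j+n+1) e\<^sub>i\<^sub>j\<close>. This
  determines \<open>\<sigma>\<close> on \<open>so (n + 1)\<close> once \<open>\<sigma>\<close> is linear.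
\<close>

definition corresponding_so_action ::
  "nat \<Rightarrow> (nat \<Rightarrow> 'a) \<Rightarrow> ('a list \<Rightarrow> 'm \<Rightarrow> 'm) \<Rightarrow> (complex mat \<Rightarrow> 'm \<Rightarrow> 'm) \<Rightarrow> bool"
  where
  "corresponding_so_action n e \<rho> \<sigma> \<longleftrightarrow>
     (\<forall>i j m. 1 \<le> i \<and> i < j \<and> j \<le> n + 1 \<longrightarrow>
        \<sigma> ((-1) ^ (i + j + n + 1) \<cdot>\<^sub>m so_basis (n + 1) i j) m
          = \<rho> (map e (filter (\<lambda>k. k \<noteq> i \<and> k \<noteq> j) [1..<n + 2])) m)"

definition has_n_lie_highest_weight ::
  "nat \<Rightarrow> (nat \<Rightarrow> 'a) \<Rightarrow> (complex \<Rightarrow> 'm::ab_group_add \<Rightarrow> 'm) \<Rightarrow> ('a list \<Rightarrow> 'm \<Rightarrow> 'm) \<Rightarrow> nat \<Rightarrow> bool"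
  where
  "has_n_lie_highest_weight n e s \<rho> t \<longleftrightarrow>
     (\<exists>B. finite B \<and> module.span s B = UNIV) \<and>
     (\<exists>\<sigma>. lie_representation (so (n + 1)) s UNIV \<sigma> \<and> corresponding_so_action n e \<rho> \<sigma> \<and>
        (n > 3 \<longrightarrow> so_irreducible_highest_weight_module (n + 1) s \<sigma>
                     (\<lambda>k. of_nat t * so_first_fundamental_weight k)) \<and>
        (n = 3 \<longrightarrow> so4_module_Mt_tensor_Mt s \<sigma> t))"

end

theory Submission
  imports Defs "HOL-Library.Multiset"
begin

text \<open>
  For \<open>n = 3\<close> the module is \<open>M\<^sub>t \<otimes> M\<^sub>t\<close>, of dimension \<open>(t + 1)\<^sup>2\<close>. Let \<open>n > 3\<close> and
  \<open>N = n + 1\<close>, and grade \<open>so N\<close> by the eigenvalues \<open>1, 0, -1\<close> of the Cartan element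
  \<open>H = -\<i> e\<^sub>1\<^sub>2\<close>. The operators \<open>Y\<^sub>j = e\<^sub>1\<^sub>j - \<i> e\<^sub>2\<^sub>j\<close>, \<open>3 \<le> j \<le> N\<close>, commute and lower the weight by 1,
  the operators \<open>X\<^sub>j = e\<^sub>1\<^sub>j + \<i> e\<^sub>2\<^sub>j\<close> raise it, and the subalgebra \<open>so (N - 2)\<close> on the remaining
  indices kills the highest weight vector \<open>v\<close>. Hence the module is spanned by the monomials in the
  \<open>Y\<^sub>j\<close> applied to \<open>v\<close>; it is a quotient of a polynomial ring in \<open>n - 1\<close> variables, on which
  \<open>X\<^sub>j\<close> acts by a second order differential operator. Calculating the common kernel of the \<open>X\<^sub>j\<close>
  shows that no nonzero polynomial of degree at most \<open>t\<close> kills \<open>v\<close>, which gives the weight spaces of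
  \<open>H\<close> with weight \<open>t - k \<ge> 0\<close> the dimension of the polynomials of degree \<open>k\<close>. The spaces with
  negative weight are their mirror images under the \<open>sl2\<close> generated by \<open>X\<^sub>j\<close> and \<open>Y\<^sub>j\<close>, for any
  fixed \<open>j\<close>.
\<close>

section \<open>Counting multisets\<close>

text \<open>Sorting by the multiplicity of \<open>a\<close> leaves a multiset over \<open>A\<close>
  of the complementary size.\<close>

lemma card_multisets_of_size_insert:
  assumes "a \<notin> A" "finite A"
  shows "card (multisets_of_size (insert a A) n) = (\<Sum>m\<le>n. card (multisets_of_size A m))"
proof -
  have "card (multisets_of_size (insert a A) n) = card (SIGMA m:{0..n}. multisets_of_size A (n - m))"
    using bij_betw_same_card[OF bij_betw_multisets_of_size_insert[OF assms(1), of n]] by simp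
  also have "\<dots> = (\<Sum>m\<le>n. card (multisets_of_size A (n - m)))"
    using assms(2) by (subst card_SigmaI) (auto simp: atLeast0AtMost)
  also have "\<dots> = (\<Sum>m\<le>n. card (multisets_of_size A m))"
    by (rule sum.reindex_bij_witness[of _ "\<lambda>m. n - m" "\<lambda>m. n - m"]) auto
  finally show ?thesis .
qed

text \<open>Stars and bars, adding one element to \<open>A\<close> at a time; the inductive step is
  the hockey-stick identity \<open>sum_choose_lower\<close>.\<close>

lemma card_multisets_of_size:
  assumes "finite A" "A \<noteq> {}"
  shows "card (multisets_of_size A n) = (card A + n - 1) choose n"
  using assms
proof (induction A arbitrary: n rule: finite_ne_induct)
  case (singleton x)
  have "multisets_of_size {x} n = {replicate_mset n x}"
    by (auto simp: multisets_of_size_def dest: set_mset_subset_singletonD split: if_splits)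
  then show ?case by simp
next
  case (insert x F)
  obtain q where q: "card F = Suc q"
    using insert.hyps by (metis card_gt_0_iff gr0_implies_Suc)
  show ?case
    using insert by (simp add: card_multisets_of_size_insert q sum_choose_lower)
qed

section \<open>Eigenvectors and sl2\<close>

context vector_space
begin

text \<open>Applying \<open>H\<close> minus the eigenvalue of one summand removes that summand and
  multiplies the others by nonzero scalars, so induction on \<open>I\<close> applies.\<close>

lemma eigenvector_sum_zero:
  assumes H: "module_hom scale scale H" and "finite I" "inj_on \<mu> I"
    and "\<And>i. i \<in> I \<Longrightarrow> H (u i) = scale (\<mu> i) (u i)" "(\<Sum>i\<in>I. u i) = 0" "i \<in> I"
  shows "u i = 0"
  using assms(2-6)
proof (induction I arbitrary: u i rule: finite_induct)
  case (insert j I)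
  interpret H: module_hom scale scale H by (rule H)
  define w where "w i = scale (\<mu> i - \<mu> j) (u i)" for i
  have "H (\<Sum>i\<in>insert j I. u i) = (\<Sum>i\<in>insert j I. scale (\<mu> i) (u i))"
    using insert.prems(2) by (simp add: H.sum del: sum.insert)
  then have "(\<Sum>i\<in>insert j I. w i) = 0"
    using insert.prems(3)
    by (simp add: w_def scale_left_diff_distrib sum_subtractf H.zero scale_sum_right[symmetric] del: sum.insert)
  then have w_sum: "(\<Sum>i\<in>I. w i) = 0"
    using insert.hyps by (simp add: w_def)
  have u0: "u i = 0" if "i \<in> I" for i
  proof -
    have "w i = 0"
      by (rule insert.IH[OF _ _ w_sum that])
        (use insert.prems in \<open>auto simp: w_def H.scale scale_left_commute\<close>)
    moreover have "\<mu> i \<noteq> \<mu> j" using insert.prems(1) insert.hyps that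
      by (metis inj_on_insert insertI1 insertI2 inj_onD)
    ultimately show ?thesis by (simp add: w_def)
  qed
  then have "(\<Sum>i\<in>I. u i) = 0" by simp
  then have "u j = 0" using insert.prems(3) insert.hyps by simp
  then show ?case using u0 insert.prems(4) by auto
qed simp

text \<open>Eigenvectors for distinct eigenvalues are independent, so a finite spanning set bounds
  their number. In this form finite dimension enters below: weight strings terminate.\<close>

lemma finite_nonzero_eigenvectors:
  assumes H: "module_hom scale scale H" and \<mu>: "inj \<mu>"
    and u: "\<And>i. H (u i) = scale (\<mu> i) (u i)" and B: "finite B" "span B = UNIV"
  shows "finite {i. u i \<noteq> 0}"
proof (rule ccontr)
  assume "infinite {i. u i \<noteq> 0}"
  then obtain S where S: "S \<subseteq> {i. u i \<noteq> 0}" "finite S" "card S = Suc (card B)"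
    using infinite_arbitrarily_large by blast
  interpret H: module_hom scale scale H by (rule H)
  have inj: "inj_on u S"
  proof (rule inj_onI)
    fix i j assume "i \<in> S" "j \<in> S" "u i = u j"
    then have "scale (\<mu> i) (u i) = scale (\<mu> j) (u i)" "u i \<noteq> 0"
      using u[of i] u[of j] S(1) by auto
    then show "i = j" using \<mu> by (auto dest: injD)
  qed
  have "independent (u ` S)"
  proof (rule independent_if_scalars_zero)
    fix f x assume sum: "(\<Sum>x\<in>u ` S. scale (f x) x) = 0" and "x \<in> u ` S"
    then obtain i where i: "i \<in> S" "x = u i" by auto
    have "(\<Sum>i\<in>S. scale (f (u i)) (u i)) = 0"
      using sum inj by (simp add: sum.reindex)
    then have "scale (f (u i)) (u i) = 0"
      by (rule eigenvector_sum_zero[OF H S(2), of \<mu>, rotated 2])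
        (use i \<mu> in \<open>auto simp: H.scale u scale_left_commute intro: inj_on_subset\<close>)
    then show "f x = 0" using i S(1) by auto
  qed (use S in simp)
  then have "card (u ` S) \<le> card B"
    using independent_span_bound[OF B(1)] B(2) by blast
  then show False using S(3) inj by (simp add: card_image)
qed

end

lemma double_of_nat_eq_iff: "2 * (of_nat s :: complex) = of_nat j \<longleftrightarrow> 2 * s = j"
  by (metis of_nat_eq_iff of_nat_mult of_nat_numeral)

text \<open>\<open>H\<close> is half of the usual Cartan element: one application of
  \<open>F\<close> changes its eigenvalue by 1, and \<open>F ^^ (2 * s)\<close> leads from weight
  \<open>s\<close> to weight \<open>- s\<close>.\<close>

locale sl2_operators = vector_space scale
  for scale :: "complex \<Rightarrow> 'm::ab_group_add \<Rightarrow> 'm" (infixr "*s" 75) +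
  fixes X F H :: "'m \<Rightarrow> 'm"
  assumes X_hom: "module_hom scale scale X"
    and F_hom: "module_hom scale scale F"
    and H_hom: "module_hom scale scale H"
    and X_F: "X (F m) = F (X m) + 2 *s H m"
    and H_X: "H (X m) = X (H m) + X m"
    and H_F: "H (F m) = F (H m) - F m"
begin

interpretation X: module_hom scale scale X by (rule X_hom)
interpretation F: module_hom scale scale F by (rule F_hom)
interpretation H: module_hom scale scale H by (rule H_hom)

text \<open>The symmetry of sl2 that exchanges raising and lowering; it transfers statements to
  lowest weight vectors.\<close>

lemma opposite: "sl2_operators scale F X (\<lambda>m. - H m)"
proof unfold_locales
  show "F (X m) = X (F m) + 2 *s - H m" for m by (simp add: X_F)
qed (simp_all add: X.add X.scale F.add F.scale H.add H.scale H_X H_F X.neg F.neg)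

lemma F_power_0: "(F ^^ k) 0 = 0"
  by (induction k) (auto simp: F.zero)

lemma F_power_add: "(F ^^ k) (u + w) = (F ^^ k) u + (F ^^ k) w"
  by (induction k) (auto simp: F.add)

lemma F_power_scale: "(F ^^ k) (c *s u) = c *s (F ^^ k) u"
  by (induction k) (auto simp: F.scale)

lemma H_F_power:
  assumes "H u = s *s u"
  shows "H ((F ^^ j) u) = (s - of_nat j) *s (F ^^ j) u"
proof (induction j)
  case (Suc j)
  have "H ((F ^^ Suc j) u) = (s - of_nat j) *s (F ^^ Suc j) u - (F ^^ Suc j) u"
    by (simp add: H_F Suc F.scale)
  also have "\<dots> = (s - of_nat (Suc j)) *s (F ^^ Suc j) u"
    by (simp add: scale_left_diff_distrib scale_left_distrib algebra_simps)
  finally show ?case .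
qed (simp add: assms)

text \<open>Moving \<open>X\<close> past each copy of \<open>F\<close> produces twice the current
  weight, and these contributions add up to the scalar. The term with \<open>X u\<close> stays
  because \<open>u\<close> need not be a highest weight vector.\<close>

lemma X_F_power:
  assumes "H u = s *s u"
  shows "X ((F ^^ Suc j) u) =
    (F ^^ Suc j) (X u) + (of_nat (Suc j) * (2 * s - of_nat j)) *s (F ^^ j) u"
proof (induction j)
  case 0
  then show ?case by (simp add: X_F assms)
next
  case (Suc j)
  have "X ((F ^^ Suc (Suc j)) u) = F (X ((F ^^ Suc j) u)) + 2 *s H ((F ^^ Suc j) u)"
    by (simp add: X_F)
  also have "\<dots> = (F ^^ Suc (Suc j)) (X u)
      + (of_nat (Suc j) * (2 * s - of_nat j) + 2 * (s - of_nat (Suc j))) *s (F ^^ Suc j) u"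
    unfolding Suc.IH H_F_power[OF assms]
    by (simp add: F.add F.scale scale_left_distrib add.assoc)
  also have "of_nat (Suc j) * (2 * s - of_nat j) + 2 * (s - of_nat (Suc j))
      = of_nat (Suc (Suc j)) * (2 * s - of_nat (Suc j))"
    by (simp add: algebra_simps)
  finally show ?case .
qed

text \<open>\<open>X\<close> sends \<open>(F ^^ Suc j) u\<close> to a multiple of
  \<open>(F ^^ j) u\<close> by a scalar that is nonzero here, so the powers of \<open>F\<close> can
  be stripped off one at a time.\<close>

lemma F_power_eq_0:
  assumes "H u = s *s u" "X u = 0" "(F ^^ k) u = 0" "\<And>j. j < k \<Longrightarrow> 2 * s \<noteq> of_nat j"
  shows "u = 0"
  using assms(3,4)
proof (induction k)
  case (Suc k)
  have "(of_nat (Suc k) * (2 * s - of_nat k)) *s (F ^^ k) u = 0"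
    using X_F_power[OF assms(1), of k] unfolding Suc.prems(1) assms(2) X.zero F_power_0 by simp
  then have "(F ^^ k) u = 0" using Suc.prems(2)[of k] by (auto simp del: of_nat_Suc)
  then show ?case using Suc by simp
qed simp

text \<open>\<open>F u\<close> has weight -1 and is again killed by \<open>X\<close>, since the
  commutator contributes \<open>2 *s H u = 0\<close>. If nonzero, it would generate an infinite
  weight string.\<close>

lemma F_highest_weight_zero:
  assumes "H u = 0" "X u = 0" "finite B" "span B = UNIV"
  shows "F u = 0"
proof -
  have H: "H ((F ^^ j) u) = (- of_nat j) *s (F ^^ j) u" for j
    using H_F_power[of u 0 j] assms(1) by simp
  have "finite {j. (F ^^ j) u \<noteq> 0}"
    by (rule finite_nonzero_eigenvectors[OF H_hom _ H assms(3,4)]) (auto intro: injI)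
  then obtain k where k: "(F ^^ k) u = 0"
    using ex_new_if_finite[OF infinite_UNIV_nat] by blast
  show ?thesis
  proof (cases k)
    case 0
    then show ?thesis using k by (simp add: F.zero)
  next
    case (Suc l)
    have "H (F u) = (-1) *s F u" "X (F u) = 0" "(F ^^ l) (F u) = 0"
      using assms k Suc by (auto simp: H_F X_F F.zero funpow_swap1)
    then show ?thesis
    proof (rule F_power_eq_0)
      fix j :: nat
      have "Re (2 * - 1) < Re (of_nat j)" by simp
      then show "2 * - 1 \<noteq> (of_nat j :: complex)" by (metis less_irrefl)
    qed
  qed
qed

lemma X_F_power_commute_0:
  assumes "H u = s *s u" "(F ^^ k) u = 0"
  shows "(F ^^ Suc k) (X u) = 0"
proof -
  have "X ((F ^^ Suc k) u) = 0" using assms(2) by (simp add: F.zero X.zero)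
  then show ?thesis using X_F_power[OF assms(1), of k] assms(2) by simp
qed

text \<open>Induction downwards from the top weight: \<open>X u\<close> satisfies the hypothesis
  with \<open>Suc s\<close> in place of \<open>s\<close> and so vanishes. Then \<open>u\<close> is a
  highest weight vector, and the scalars along its string are nonzero.\<close>

lemma F_power_inj:
  assumes top: "\<And>s u. s \<ge> T \<Longrightarrow> H u = of_nat s *s u \<Longrightarrow> u = 0"
    and u: "H u = of_nat s *s u" "(F ^^ (2 * s)) u = 0"
  shows "u = 0"
  using u
proof (induction "T - s" arbitrary: s u rule: less_induct)
  case less
  show ?case
  proof (cases "s \<ge> T")
    case True
    then show ?thesis using top less.prems by blast
  next
    case False
    have HX: "H (X u) = of_nat (Suc s) *s X u"
      using less.prems(1) by (simp add: H_X X.scale scale_left_distrib)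
    have "(F ^^ Suc (2 * s)) (X u) = 0"
      by (rule X_F_power_commute_0) (use less.prems in auto)
    then have "(F ^^ (2 * Suc s)) (X u) = 0" by (simp add: F.zero)
    then have "X u = 0"
      using less.hyps[OF _ HX] False by simp
    then show ?thesis
      by (rule F_power_eq_0[OF less.prems(1) _ less.prems(2)])
        (use double_of_nat_eq_iff in auto)
  qed
qed

interpretation op: sl2_operators scale F X "\<lambda>m. - H m" by (rule opposite)

text \<open>On a lowest weight vector \<open>F\<close> undoes each \<open>X\<close> up to a nonzero
  scalar, by the opposite version of \<open>X_F_power\<close>.\<close>

lemma F_power_surj_lowest:
  assumes u: "H u = (- s) *s u" "F u = 0" and k: "\<And>j. j < k \<Longrightarrow> 2 * s \<noteq> of_nat j"
  shows "\<exists>c. u = c *s (F ^^ k) ((X ^^ k) u)"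
  using k
proof (induction k)
  case 0
  show ?case by (intro exI[of _ 1]) simp
next
  case (Suc k)
  then obtain c where c: "u = c *s (F ^^ k) ((X ^^ k) u)" by auto
  let ?d = "of_nat (Suc k) * (2 * s - of_nat k) :: complex"
  have "?d \<noteq> 0" using Suc.prems[of k] by (simp del: of_nat_Suc)
  have "(X ^^ Suc k) (F u) = 0"
    unfolding u(2) by (rule op.F_power_0)
  then have "F ((X ^^ Suc k) u) = ?d *s (X ^^ k) u"
    using op.X_F_power[of u s k] u(1) by (simp del: funpow.simps)
  then have "(F ^^ Suc k) ((X ^^ Suc k) u) = (F ^^ k) (?d *s (X ^^ k) u)"
    by (simp add: funpow_swap1)
  also have "\<dots> = ?d *s (F ^^ k) ((X ^^ k) u)"
    by (rule F_power_scale)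
  finally have "u = (c / ?d) *s (F ^^ Suc k) ((X ^^ Suc k) u)"
    using c \<open>?d \<noteq> 0\<close> by simp
  then show ?case by blast
qed

text \<open>The counterpart of \<open>F_power_inj\<close>, by induction upwards from the lowest
  weights: \<open>F u\<close> is an image by the induction hypothesis, and correcting
  \<open>u\<close> accordingly leaves a lowest weight vector, to which
  \<open>F_power_surj_lowest\<close> applies.\<close>

lemma F_power_surj:
  assumes bottom: "\<And>s u. s \<ge> K \<Longrightarrow> H u = (- of_nat s) *s u \<Longrightarrow> u = 0"
    and u: "H u = (- of_nat s) *s u"
  shows "\<exists>w. H w = of_nat s *s w \<and> (F ^^ (2 * s)) w = u"
  using u
proof (induction "K - s" arbitrary: s u rule: less_induct)
  case less
  show ?case
  proof (cases "s \<ge> K")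
    case True
    then have "u = 0" using bottom less.prems by blast
    then show ?thesis using F_power_0 by (intro exI[of _ 0]) (simp add: H.zero)
  next
    case False
    have HFu: "H (F u) = (- of_nat (Suc s)) *s F u"
      using less.prems by (simp add: H_F F.scale F.neg scale_left_distrib scale_left_diff_distrib)
    then obtain w where w: "H w = of_nat (Suc s) *s w" "(F ^^ (2 * Suc s)) w = F u"
      using less.hyps[OF _ HFu] False by fastforce
    have Fw: "H (F w) = of_nat s *s F w"
      using w(1) by (simp add: H_F F.add F.scale scale_left_distrib)
    define u' where "u' = u - (F ^^ (2 * s)) (F w)"
    have "F ((F ^^ (2 * s)) (F w)) = F u"
      using w(2) by (simp add: funpow_swap1)
    then have "F u' = 0" by (simp add: u'_def F.diff)
    moreover have "H u' = (- of_nat s) *s u'"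
      using less.prems H_F_power[OF Fw, of "2 * s"]
      by (simp add: u'_def H.diff scale_right_diff_distrib)
    ultimately obtain c where c: "u' = c *s (F ^^ (2 * s)) ((X ^^ (2 * s)) u')"
      using F_power_surj_lowest[of u' "of_nat s" "2 * s"] by (auto simp: double_of_nat_eq_iff)
    have "- H ((X ^^ (2 * s)) u') = (of_nat s - of_nat (2 * s)) *s (X ^^ (2 * s)) u'"
      by (rule op.H_F_power) (simp add: \<open>H u' = (- of_nat s) *s u'\<close>)
    then have Xu: "H ((X ^^ (2 * s)) u') = of_nat s *s (X ^^ (2 * s)) u'"
      by (simp add: scale_left_diff_distrib scale_left_distrib minus_equation_iff)
    have "u = (F ^^ (2 * s)) (F w) + u'" by (simp add: u'_def)
    also have "\<dots> = (F ^^ (2 * s)) (F w + c *s (X ^^ (2 * s)) u')"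
      using c by (simp add: F_power_add F_power_scale)
    finally have "(F ^^ (2 * s)) (F w + c *s (X ^^ (2 * s)) u') = u" by simp
    moreover have "H (F w + c *s (X ^^ (2 * s)) u') = of_nat s *s (F w + c *s (X ^^ (2 * s)) u')"
      by (simp add: H.add H.scale Fw Xu scale_right_distrib scale_left_commute)
    ultimately show ?thesis by blast
  qed
qed

end

section \<open>Operators satisfying the relations of the orthogonal Lie algebra\<close>

text \<open>The commutation relations of the e_ij for an orthonormal basis, on an arbitrary index
  set, so that the argument below is free of matrices.\<close>

locale so_operators = vector_space scale
  for scale :: "complex \<Rightarrow> 'm::ab_group_add \<Rightarrow> 'm" (infixr "*s" 75) +
  fixes I :: "'i set" and E :: "'i \<Rightarrow> 'i \<Rightarrow> 'm \<Rightarrow> 'm"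
  assumes E_hom: "module_hom scale scale (E i j)"
    and E_diag: "E i i m = 0"
    and E_antisym: "E j i m = - E i j m"
    and E_commute: "\<lbrakk>i \<in> I; j \<in> I; k \<in> I; l \<in> I\<rbrakk> \<Longrightarrow>
      E i j (E k l m) = E k l (E i j m) + (if j = k then E i l m else 0) - (if i = k then E j l m else 0)
        - (if j = l then E i k m else 0) + (if i = l then E j k m else 0)"
begin

lemmas E_add = module_hom.add[OF E_hom]
  and E_scale = module_hom.scale[OF E_hom]
  and E_neg = module_hom.neg[OF E_hom]
  and E_diff = module_hom.diff[OF E_hom]

text \<open>For \<open>p = 1\<close> and \<open>q = 2\<close> this and the next two definitions are
  X_j, Y_j and H of the outline; other pairs serve for the rest of the Cartan subalgebra.\<close>

definition raise :: "'i \<Rightarrow> 'i \<Rightarrow> 'i \<Rightarrow> 'm \<Rightarrow> 'm" where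
  "raise p q j m = E p j m + \<i> *s E q j m"

definition lower :: "'i \<Rightarrow> 'i \<Rightarrow> 'i \<Rightarrow> 'm \<Rightarrow> 'm" where
  "lower p q j m = E p j m - \<i> *s E q j m"

definition weight_op :: "'i \<Rightarrow> 'i \<Rightarrow> 'm \<Rightarrow> 'm" where
  "weight_op p q m = (- \<i>) *s E p q m"

lemmas op_defs = raise_def lower_def weight_op_def

lemma module_hom_selfI:
  assumes "\<And>x y. f (x + y) = f x + f y" "\<And>c x. f (c *s x) = c *s f x"
  shows "module_hom scale scale f"
  using assms by unfold_locales

lemma raise_hom: "module_hom scale scale (raise p q j)"
  by (rule module_hom_selfI)
    (simp_all add: raise_def E_add E_scale scale_right_distrib scale_left_commute)

lemma lower_hom: "module_hom scale scale (lower p q j)"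
  by (rule module_hom_selfI)
    (simp_all add: lower_def E_add E_scale scale_right_distrib scale_right_diff_distrib scale_left_commute)

lemma weight_op_hom: "module_hom scale scale (weight_op p q)"
  by (rule module_hom_selfI)
    (simp_all add: weight_op_def E_add E_scale scale_right_distrib scale_left_commute)

lemma double: "2 *s m = m + m"
  by (metis one_add_one scale_left_distrib scale_one)

section \<open>Commutators of raising, lowering and weight operators\<close>

context
  fixes p q j
  assumes pqj: "p \<in> I" "q \<in> I" "j \<in> I" "p \<noteq> q" "j \<noteq> p" "j \<noteq> q"
begin

lemma weight_raise: "weight_op p q (raise p q j m) = raise p q j (weight_op p q m) + raise p q j m"
proof -
  have 1: "E p q (E p j m) = E p j (E p q m) - E q j m"
    by (subst E_commute) (use pqj in \<open>auto\<close>)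
  have 2: "E p q (E q j m) = E q j (E p q m) + E p j m"
    by (subst E_commute) (use pqj in \<open>auto\<close>)
  show ?thesis
    by (simp add: op_defs E_add E_scale 1 2 scale_right_distrib scale_right_diff_distrib E_neg)
qed

lemma weight_lower: "weight_op p q (lower p q j m) = lower p q j (weight_op p q m) - lower p q j m"
proof -
  have 1: "E p q (E p j m) = E p j (E p q m) - E q j m"
    by (subst E_commute) (use pqj in \<open>auto\<close>)
  have 2: "E p q (E q j m) = E q j (E p q m) + E p j m"
    by (subst E_commute) (use pqj in \<open>auto\<close>)
  show ?thesis
    by (simp add: op_defs E_diff E_scale 1 2 scale_right_distrib scale_right_diff_distrib E_neg)
qed

lemma raise_lower:
  assumes k: "k \<in> I" "k \<noteq> p" "k \<noteq> q"
  shows "raise p q j (lower p q k m) =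
    lower p q k (raise p q j m) - 2 *s E j k m - (if j = k then 2 *s weight_op p q m else 0)"
proof -
  have 1: "E p j (E p k m) = E p k (E p j m) - E j k m"
    by (subst E_commute) (use pqj k in \<open>auto simp: E_diag\<close>)
  have 2: "E p j (E q k m) = E q k (E p j m) - (if j = k then E p q m else 0)"
    by (subst E_commute) (use pqj k in \<open>auto\<close>)
  have 3: "E q j (E p k m) = E p k (E q j m) + (if j = k then E p q m else 0)"
    by (subst E_commute) (use pqj k in \<open>auto simp: E_antisym[of q p]\<close>)
  have 4: "E q j (E q k m) = E q k (E q j m) - E j k m"
    by (subst E_commute) (use pqj k in \<open>auto simp: E_diag\<close>)
  have 5: "(2 * \<i>) *s E p q m = \<i> *s E p q m + \<i> *s E p q m"
    by (simp only: mult_2 scale_left_distrib)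
  show ?thesis
    by (simp add: op_defs E_add E_diff E_scale 1 2 3 4 5 scale_right_distrib scale_right_diff_distrib
        E_neg double)
qed

text \<open>The terms \<open>E j k m\<close> from \<open>p\<close> and from \<open>q\<close> cancel
  because \<open>\<i>\<close> squares to -1; in \<open>raise_lower\<close>, with one sign reversed,
  they add up.\<close>

lemma lower_lower:
  assumes k: "k \<in> I" "k \<noteq> p" "k \<noteq> q"
  shows "lower p q j (lower p q k m) = lower p q k (lower p q j m)"
proof -
  have 1: "E p j (E p k m) = E p k (E p j m) - E j k m"
    by (subst E_commute) (use pqj k in \<open>auto simp: E_diag\<close>)
  have 2: "E p j (E q k m) = E q k (E p j m) - (if j = k then E p q m else 0)"
    by (subst E_commute) (use pqj k in \<open>auto\<close>)
  have 3: "E q j (E p k m) = E p k (E q j m) + (if j = k then E p q m else 0)"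
    by (subst E_commute) (use pqj k in \<open>auto simp: E_antisym[of q p]\<close>)
  have 4: "E q j (E q k m) = E q k (E q j m) - E j k m"
    by (subst E_commute) (use pqj k in \<open>auto simp: E_diag\<close>)
  show ?thesis
    by (simp add: op_defs E_add E_diff E_scale 1 2 3 4 scale_right_distrib scale_right_diff_distrib
        E_neg)
qed

lemma E_lower:
  assumes k: "i \<in> I" "i \<noteq> p" "i \<noteq> q" "k \<in> I" "k \<noteq> p" "k \<noteq> q"
  shows "E i j (lower p q k m) = lower p q k (E i j m)
    + (if j = k then lower p q i m else 0) - (if i = k then lower p q j m else 0)"
proof -
  have 1: "E i j (E p k m) = E p k (E i j m) + (if j = k then E p i m else 0) - (if i = k then E p j m else 0)"
    by (subst E_commute) (use pqj k in \<open>auto simp: E_antisym[of _ p]\<close>)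
  have 2: "E i j (E q k m) = E q k (E i j m) + (if j = k then E q i m else 0) - (if i = k then E q j m else 0)"
    by (subst E_commute) (use pqj k in \<open>auto simp: E_antisym[of _ q]\<close>)
  show ?thesis
    by (simp add: op_defs E_add E_diff E_scale 1 2 scale_right_distrib scale_right_diff_distrib)
qed

text \<open>The commutator of \<open>raise\<close> and \<open>lower\<close> for the same index is
  minus twice the weight operator, hence the sign in front of \<open>lower\<close>.\<close>

lemma sl2: "sl2_operators scale (raise p q j) (\<lambda>m. - lower p q j m) (weight_op p q)"
proof unfold_locales
  show "raise p q j (- lower p q j m) = - lower p q j (raise p q j m) + 2 *s weight_op p q m" for m
    using pqj by (simp add: module_hom.neg[OF raise_hom] raise_lower E_diag)
qed (use weight_raise weight_lower in \<open>simp_all add: module_hom.add[OF raise_hom]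
    module_hom.add[OF lower_hom] module_hom.add[OF weight_op_hom] module_hom.scale[OF raise_hom]
    module_hom.scale[OF lower_hom] module_hom.scale[OF weight_op_hom] module_hom.neg[OF weight_op_hom]\<close>)

end

end

section \<open>Highest weight modules with weight a multiple of the first fundamental weight\<close>

text \<open>The index shift after a differentiation: a multiset containing \<open>j\<close> is
  \<open>add_mset j B\<close> for exactly one \<open>B\<close>.\<close>

lemma sum_multisets_of_size_remove:
  fixes h :: "'i multiset \<Rightarrow> 'm::ab_group_add"
  assumes J: "finite J" "j \<in> J" and h: "\<And>A. j \<notin># A \<Longrightarrow> h A = 0"
  shows "(\<Sum>A\<in>multisets_of_size J (Suc k). h A) = (\<Sum>B\<in>multisets_of_size J k. h (add_mset j B))"
proof -
  have "(\<Sum>B\<in>multisets_of_size J k. h (add_mset j B)) =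
    (\<Sum>A\<in>add_mset j ` multisets_of_size J k. h A)"
    by (subst sum.reindex) (auto simp: inj_on_def)
  also have "\<dots> = (\<Sum>A\<in>multisets_of_size J (Suc k). h A)"
  proof (rule sum.mono_neutral_left)
    show "finite (multisets_of_size J (Suc k))" using J by blast
    show "add_mset j ` multisets_of_size J k \<subseteq> multisets_of_size J (Suc k)"
      using J by (auto simp: multisets_of_size_def)
    show "\<forall>A\<in>multisets_of_size J (Suc k) - add_mset j ` multisets_of_size J k. h A = 0"
    proof (intro ballI h notI)
      fix A assume A: "A \<in> multisets_of_size J (Suc k) - add_mset j ` multisets_of_size J k" "j \<in># A"
      then obtain B where "A = add_mset j B" by (metis insert_DiffM)
      with A show False by (auto simp: multisets_of_size_def)
    qed
  qed
  finally show ?thesis ..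
qed

lemma size_eq_sum_count:
  assumes "finite J" "set_mset A \<subseteq> J"
  shows "(\<Sum>i\<in>J. count A i) = size A"
  unfolding size_multiset_overloaded_eq
  using assms by (intro sum.mono_neutral_right) (auto simp: not_in_iff)

text \<open>\<open>p\<close> and \<open>q\<close> are the two distinguished indices.
  \<open>E_v\<close> is the property special to multiples of the first fundamental weight: the
  orthogonal algebra on the other indices kills \<open>v\<close>.\<close>

locale so_weight_module = so_operators scale I E
  for scale :: "complex \<Rightarrow> 'm::ab_group_add \<Rightarrow> 'm" (infixr "*s" 75)
    and I :: "'i set" and E :: "'i \<Rightarrow> 'i \<Rightarrow> 'm \<Rightarrow> 'm" +
  fixes p q :: 'i and t :: nat and v :: 'm
  assumes finite_I: "finite I" and pq: "p \<in> I" "q \<in> I" "p \<noteq> q" and J_nonempty: "I - {p, q} \<noteq> {}"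
    and finite_dim: "\<exists>B. finite B \<and> span B = UNIV"
    and v_nonzero: "v \<noteq> 0"
    and weight_v: "weight_op p q v = of_nat t *s v"
    and raise_v: "j \<in> I - {p, q} \<Longrightarrow> raise p q j v = 0"
    and E_v: "\<lbrakk>i \<in> I - {p, q}; j \<in> I - {p, q}\<rbrakk> \<Longrightarrow> E i j v = 0"
    and irreducible: "\<lbrakk>subspace W; \<And>i j w. \<lbrakk>i \<in> I; j \<in> I; w \<in> W\<rbrakk> \<Longrightarrow> E i j w \<in> W\<rbrakk> \<Longrightarrow>
      W = {0} \<or> W = UNIV"
begin

definition J :: "'i set" where "J = I - {p, q}"

lemma finite_J: "finite J" and J_ne: "J \<noteq> {}"
  using finite_I J_nonempty by (auto simp: J_def)

abbreviation H where "H \<equiv> weight_op p q"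

text \<open>Extended by 0 outside \<open>J\<close>, so that the operators commute for all indices
  and can be folded over a multiset.\<close>

definition low :: "'i \<Rightarrow> 'm \<Rightarrow> 'm" where
  "low j m = (if j \<in> J then lower p q j m else 0)"

lemma low_hom: "module_hom scale scale (low j)"
  by (rule module_hom_selfI)
    (auto simp: low_def module_hom.add[OF lower_hom] module_hom.scale[OF lower_hom])

lemmas low_add = module_hom.add[OF low_hom]
  and low_scale = module_hom.scale[OF low_hom]
  and low_zero = module_hom.zero[OF low_hom]
  and low_neg = module_hom.neg[OF low_hom]
  and low_diff = module_hom.diff[OF low_hom]
  and low_sum = module_hom.sum[OF low_hom]

lemmas raise_scale = module_hom.scale[OF raise_hom]
  and raise_sum = module_hom.sum[OF raise_hom]
  and raise_zero = module_hom.zero[OF raise_hom]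

lemma low_commute: "low j (low k m) = low k (low j m)"
  unfolding low_def using pq
  by (auto simp: J_def module_hom.zero[OF lower_hom] intro: lower_lower)

sublocale low: comp_fun_commute low
  by unfold_locales (simp add: fun_eq_iff low_commute)

lemma H_low: "j \<in> J \<Longrightarrow> H (low j m) = low j (H m) - low j m"
  using weight_lower[of p q j m] pq by (auto simp: low_def J_def)

lemma E_low:
  "\<lbrakk>i \<in> J; j \<in> J; k \<in> J\<rbrakk> \<Longrightarrow>
    E i j (low k m) = low k (E i j m) + (if j = k then low i m else 0) - (if i = k then low j m else 0)"
  using E_lower[of p q j i k m] pq by (auto simp: low_def J_def)

lemma raise_low:
  "\<lbrakk>j \<in> J; k \<in> J\<rbrakk> \<Longrightarrow> raise p q j (low k m) =
    low k (raise p q j m) - 2 *s E j k m - (if j = k then 2 *s H m else 0)"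
  using raise_lower[of p q j k m] pq by (auto simp: low_def J_def)

definition mon :: "'i multiset \<Rightarrow> 'm" where
  "mon A = fold_mset low v A"

lemma mon_empty [simp]: "mon {#} = v"
  and mon_add [simp]: "mon (add_mset j A) = low j (mon A)"
  by (simp_all add: mon_def)

text \<open>
  Read \<open>mon A\<close> as a monomial in commuting variables: \<open>D j\<close> is then the partial derivative with
  respect to the variable \<open>j\<close>, and \<open>raise p q j\<close> acts as the differential operator
  \<open>- 2 (t - deg) \<partial>\<^sub>j - x\<^sub>j \<Delta>\<close>, where \<open>deg\<close> is the degree after differentiation.
\<close>

definition D :: "'i \<Rightarrow> 'i multiset \<Rightarrow> 'm" where
  "D j A = of_nat (count A j) *s mon (A - {#j#})"

definition D2 :: "'i \<Rightarrow> 'i multiset \<Rightarrow> 'm" where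
  "D2 j A = of_nat (count A j) *s D j (A - {#j#})"

lemma D_empty [simp]: "D j {#} = 0" and D2_empty [simp]: "D2 j {#} = 0"
  by (simp_all add: D_def D2_def)

lemma low_D: "low j (D j A) = of_nat (count A j) *s mon A"
proof (cases "j \<in># A")
  case True
  then have "low j (mon (A - {#j#})) = mon A" by (metis insert_DiffM mon_add)
  then show ?thesis by (simp add: D_def low_scale)
next
  case False
  then show ?thesis by (simp add: D_def low_zero not_in_iff)
qed

text \<open>Leibniz rule. \<open>D\<close> takes multisets rather than vectors because the monomials
  are not yet known to be independent.\<close>

lemma D_add [simp]: "D j (add_mset k A) = low k (D j A) + (if j = k then mon A else 0)"
proof (cases "j \<in># A")
  case True
  then have "add_mset k A - {#j#} = add_mset k (A - {#j#})" by auto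
  moreover have "j = k \<Longrightarrow> low j (mon (A - {#j#})) = mon A"
    using True by (metis insert_DiffM mon_add)
  ultimately show ?thesis
    by (auto simp: D_def low_scale scale_left_distrib)
next
  case False
  then show ?thesis by (auto simp: D_def low_zero not_in_iff)
qed

lemma D2_add [simp]: "D2 j (add_mset k A) = low k (D2 j A) + (if j = k then 2 *s D j A else 0)"
proof (cases "j \<in># A")
  case True
  then obtain B where B: "A = add_mset j B" by (metis insert_DiffM)
  then show ?thesis
    by (auto simp: D2_def low_D low_scale low_add scale_left_distrib scale_right_distrib distrib_right
        add.commute double)
next
  case False
  then show ?thesis by (auto simp: D2_def D_def low_zero not_in_iff)
qed

lemma H_mon: "set_mset A \<subseteq> J \<Longrightarrow> H (mon A) = (of_nat t - of_nat (size A)) *s mon A"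
proof (induction A)
  case empty
  show ?case by (simp add: weight_v)
next
  case (add j A)
  then have "H (mon (add_mset j A)) =
      (of_nat t - of_nat (size A)) *s low j (mon A) - 1 *s low j (mon A)"
    by (simp add: H_low low_scale)
  then show ?case
    unfolding scale_left_diff_distrib[symmetric] by (simp add: diff_diff_eq)
qed

text \<open>\<open>E i j\<close> kills \<open>v\<close> and commutes with the \<open>low k\<close>
  like a derivation, so it acts as the rotation field x_i d_j - x_j d_i.\<close>

lemma E_mon:
  assumes "i \<in> J" "j \<in> J"
  shows "set_mset A \<subseteq> J \<Longrightarrow> E i j (mon A) = low i (D j A) - low j (D i A)"
proof (induction A)
  case empty
  show ?case using E_v assms by (simp add: low_zero J_def)
next
  case (add k A)
  then show ?case using assms
    by (auto simp: E_low low_add low_diff low_commute[of k] low_commute[of j i] low_zero)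
qed

lemma raise_mon:
  assumes "j \<in> J"
  shows "set_mset A \<subseteq> J \<Longrightarrow> raise p q j (mon A) =
    - ((2 * (of_nat t - of_nat (size A) + 1)) *s D j A) - low j (\<Sum>i\<in>J. D2 i A)"
proof (induction A)
  case empty
  show ?case using raise_v assms by (simp add: low_zero J_def)
next
  case (add k A)
  have k: "k \<in> J" "set_mset A \<subseteq> J" using add.prems by auto
  let ?a = "of_nat t - of_nat (size A) :: complex"
  let ?S = "\<Sum>i\<in>J. D2 i A"
  have D2: "(\<Sum>i\<in>J. D2 i (add_mset k A)) = low k ?S + 2 *s D k A"
    using k finite_J by (simp add: sum.distrib low_sum)
  have "raise p q j (mon (add_mset k A)) = low k (raise p q j (mon A)) - 2 *s E j k (mon A)
      - (if j = k then 2 *s H (mon A) else 0)"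
    using assms k by (simp add: raise_low)
  \<comment> \<open>The \<open>low k (D j A)\<close> part of \<open>E j k (mon A)\<close> turns the
    factor \<open>2 * (?a + 1)\<close> into \<open>2 * ?a\<close>; its \<open>low j (D k A)\<close>
    part is the cross term in the Laplacian of a product.\<close>
  also have "\<dots> = - ((2 * ?a) *s low k (D j A)) - low k (low j ?S) - 2 *s low j (D k A)
      - (if j = k then (2 * ?a) *s mon A else 0)"
    using assms k add.IH
    by (simp add: E_mon H_mon low_diff low_neg low_scale scale_right_diff_distrib
        scale_left_distrib distrib_left double)
  also have "\<dots> = - ((2 * ?a) *s D j (add_mset k A)) - low j (\<Sum>i\<in>J. D2 i (add_mset k A))"
    unfolding D2 by (simp add: low_add low_scale low_commute[of k j] scale_right_distrib)
  finally show ?case by simp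
qed

text \<open>Let f be the polynomial with coefficients \<open>c\<close>. Applying each
  \<open>raise p q j\<close> and using induction on the degree gives polynomial equations: a
  multiple of d_j f plus x_j times the Laplacian of f is 0. Their divergence shows that a positive
  multiple of the Laplacian vanishes; hence so do all d_j f, and f itself.\<close>

lemma mon_coeff_zero:
  assumes "k \<le> t" "(\<Sum>A\<in>multisets_of_size J k. c A *s mon A) = 0" "A \<in> multisets_of_size J k"
  shows "c A = 0"
  using assms
proof (induction k arbitrary: c A)
  case 0
  then show ?case using v_nonzero by simp
next
  case (Suc k)
  \<comment> \<open>\<open>L\<close> collects the coefficients of the Laplacian, \<open>d j\<close>
    those of the image under \<open>raise p q j\<close>; \<open>r\<close> is the scalar of
    \<open>raise_mon\<close> in degree \<open>Suc k\<close>.\<close>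
  define L where "L D = (\<Sum>i\<in>J. of_nat (Suc (count D i)) *
    (of_nat (Suc (Suc (count D i))) * c (add_mset i (add_mset i D))))" for D
  define r :: complex where "r = 2 * (of_nat t - of_nat k)"
  define d where "d j B = - (r * (of_nat (Suc (count B j)) * c (add_mset j B)))
    - (if j \<in># B then L (B - {#j#}) else 0)" for j B
  have D_sum: "(\<Sum>A\<in>multisets_of_size J (Suc k). c A *s D j A) =
      (\<Sum>B\<in>multisets_of_size J k. (of_nat (Suc (count B j)) * c (add_mset j B)) *s mon B)"
    if "j \<in> J" for j
    using that finite_J
    by (subst sum_multisets_of_size_remove[where j = j])
      (auto simp: D_def not_in_iff mult.commute simp del: D_add)
  have D2_sum: "(\<Sum>A\<in>multisets_of_size J (Suc k). c A *s low j (\<Sum>i\<in>J. D2 i A)) =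
      (\<Sum>B\<in>multisets_of_size J k. (if j \<in># B then L (B - {#j#}) else 0) *s mon B)"
    if j: "j \<in> J" for j
  proof (cases k)
    case 0
    have "D2 i A = 0" if "A \<in> multisets_of_size J (Suc 0)" for A i
      using size_1_singleton_mset[of A] that by (auto simp: multisets_of_size_def low_zero)
    with 0 show ?thesis by (simp add: low_zero)
  next
    case (Suc l)
    have "(\<Sum>A\<in>multisets_of_size J (Suc k). c A *s low j (\<Sum>i\<in>J. D2 i A)) =
       (\<Sum>i\<in>J. low j (\<Sum>A\<in>multisets_of_size J (Suc k). c A *s D2 i A))"
      by (simp add: low_sum low_scale scale_sum_right) (rule sum.swap)
    also have "\<dots> = (\<Sum>i\<in>J. low j (\<Sum>D\<in>multisets_of_size J l.
        (of_nat (Suc (count D i)) *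
    (of_nat (Suc (Suc (count D i))) * c (add_mset i (add_mset i D)))) *s mon D))"
    proof (rule sum.cong[OF refl], rule arg_cong[where f = "low j"])
      fix i assume i: "i \<in> J"
      have "(\<Sum>A\<in>multisets_of_size J (Suc k). c A *s D2 i A) =
          (\<Sum>A\<in>multisets_of_size J (Suc l). (c (add_mset i A) * of_nat (Suc (count A i))) *s D i A)"
        unfolding Suc using i finite_J
        by (subst sum_multisets_of_size_remove[where j = i])
          (auto simp: D2_def not_in_iff simp del: D2_add)
      also have "\<dots> = (\<Sum>D\<in>multisets_of_size J l. (of_nat (Suc (count D i)) *
          (of_nat (Suc (Suc (count D i))) * c (add_mset i (add_mset i D)))) *s mon D)"
        using i finite_J
        by (subst sum_multisets_of_size_remove[where j = i])
          (auto simp: D_def not_in_iff mult_ac simp del: D_add)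
      finally show "(\<Sum>A\<in>multisets_of_size J (Suc k). c A *s D2 i A) =
          (\<Sum>D\<in>multisets_of_size J l. (of_nat (Suc (count D i)) *
          (of_nat (Suc (Suc (count D i))) * c (add_mset i (add_mset i D)))) *s mon D)" .
    qed
    also have "\<dots> = (\<Sum>D\<in>multisets_of_size J l. L D *s mon (add_mset j D))"
      by (simp add: L_def low_sum low_scale scale_sum_left) (rule sum.swap)
    also have "\<dots> = (\<Sum>B\<in>multisets_of_size J k. (if j \<in># B then L (B - {#j#}) else 0) *s mon B)"
      unfolding Suc using j finite_J
      by (subst sum_multisets_of_size_remove[where j = j]) auto
    finally show ?thesis .
  qed
  have d0: "d j B = 0" if j: "j \<in> J" and B: "B \<in> multisets_of_size J k" for j B
  proof (rule Suc.IH)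
    have "0 = raise p q j (\<Sum>A\<in>multisets_of_size J (Suc k). c A *s mon A)"
      unfolding Suc.prems(2) by (simp add: raise_zero)
    also have "\<dots> = (\<Sum>A\<in>multisets_of_size J (Suc k). - (r *s (c A *s D j A)) - c A *s low j (\<Sum>i\<in>J. D2 i A))"
      unfolding raise_sum
    proof (rule sum.cong[OF refl])
      fix A assume "A \<in> multisets_of_size J (Suc k)"
      then have A: "set_mset A \<subseteq> J" "size A = Suc k" by (auto simp: multisets_of_size_def)
      show "raise p q j (c A *s mon A) = - (r *s (c A *s D j A)) - c A *s low j (\<Sum>i\<in>J. D2 i A)"
        unfolding raise_scale raise_mon[OF j A(1)]
        by (simp add: A(2) r_def scale_right_diff_distrib mult_ac)
    qed
    also have "\<dots> = (\<Sum>B\<in>multisets_of_size J k. d j B *s mon B)"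
      unfolding sum_subtractf sum_negf scale_sum_right[symmetric] D_sum[OF j] D2_sum[OF j]
      by (simp add: d_def scale_left_diff_distrib sum_subtractf sum_negf scale_sum_right)
    finally show "(\<Sum>B\<in>multisets_of_size J k. d j B *s mon B) = 0" ..
  qed (use Suc.prems B in auto)
  \<comment> \<open>The divergence of the equations \<open>d j B = 0\<close>. By Euler's identity,
    multiplying by x_j, applying d_j and summing over \<open>j\<close> multiplies a polynomial of
    degree \<open>size D\<close> by \<open>card J + size D\<close>.\<close>
  have L0: "L D = 0" if D: "Suc (size D) = k" "set_mset D \<subseteq> J" for D
  proof -
    have "0 = (\<Sum>j\<in>J. of_nat (Suc (count D j)) * d j (add_mset j D))"
      using D by (intro sum.neutral[symmetric]) (auto simp: d0 multisets_of_size_def)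
    also have "\<dots> = (\<Sum>j\<in>J. - (r * (of_nat (Suc (count D j)) *
        (of_nat (Suc (Suc (count D j))) * c (add_mset j (add_mset j D))))) - of_nat (Suc (count D j)) * L D)"
      by (rule sum.cong) (simp_all add: d_def right_diff_distrib mult_ac del: of_nat_Suc)
    also have "\<dots> = - (r * L D) - (\<Sum>j\<in>J. of_nat (Suc (count D j))) * L D"
      unfolding sum_subtractf sum_negf sum_distrib_left[symmetric] sum_distrib_right[symmetric]
      by (simp only: L_def)
    also have "(\<Sum>j\<in>J. of_nat (Suc (count D j)) :: complex) = of_nat (card J + size D)"
      using size_eq_sum_count[OF finite_J D(2)] by (simp add: sum.distrib flip: of_nat_sum)
    also have "r = of_nat (2 * (t - k))"
      using Suc.prems(1) by (simp add: r_def of_nat_diff)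
    finally have "of_nat (2 * (t - k)) * L D + of_nat (card J + size D) * L D = 0"
      by (simp only: eq_diff_eq add_eq_0_iff add_0)
    then have "of_nat (2 * (t - k) + (card J + size D)) * L D = 0"
      by (simp only: of_nat_add distrib_right)
    moreover have "card J > 0" using finite_J J_ne by (simp add: card_gt_0_iff)
    ultimately show ?thesis by (metis add_is_0 less_not_refl2 mult_eq_0_iff of_nat_eq_0_iff)
  qed
  have A: "set_mset A \<subseteq> J" "size A = Suc k" using Suc.prems(3) by (auto simp: multisets_of_size_def)
  then obtain j B where jB: "A = add_mset j B" by (metis size_eq_Suc_imp_eq_union)
  have "(if j \<in># B then L (B - {#j#}) else 0) = 0"
    using A jB by (auto intro!: L0 dest: in_diffD simp: size_Suc_Diff1 simp del: size_Diff_singleton)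
  then have "r * (of_nat (Suc (count B j)) * c A) = 0"
    using d0[of j B] A jB by (simp add: d_def multisets_of_size_def)
  \<comment> \<open>This is where the bound on the degree matters: \<open>Suc k \<le> t\<close>
    gives \<open>k < t\<close>.\<close>
  moreover have "r \<noteq> 0" using Suc.prems(1) by (simp add: r_def)
  ultimately show ?case by (simp del: of_nat_Suc)
qed

end

section \<open>Dimension from an indexed basis\<close>

context vector_space
begin

lemma dim_UNIV_family:
  assumes "finite K"
    and indep: "\<And>c x. (\<Sum>x\<in>K. scale (c x) (b x)) = 0 \<Longrightarrow> x \<in> K \<Longrightarrow> c x = 0"
    and "span (b ` K) = UNIV"
  shows "dim UNIV = card K"
proof -
  have inj: "inj_on b K"
  proof (rule inj_onI, rule ccontr)
    fix x y assume xy: "x \<in> K" "y \<in> K" "b x = b y" "x \<noteq> y"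
    \<comment> \<open>Two indices with the same vector would give a nontrivial relation.\<close>
    have "(\<Sum>z\<in>K. scale (if z = x then 1 else if z = y then - 1 else 0) (b z)) =
        (\<Sum>z\<in>{x, y}. scale (if z = x then 1 else if z = y then - 1 else 0) (b z))"
      using assms(1) xy by (intro sum.mono_neutral_right) auto
    also have "\<dots> = 0" using xy by simp
    finally show False using indep[OF _ xy(1)] by fastforce
  qed
  have "independent (b ` K)"
  proof (rule independent_if_scalars_zero)
    fix f x assume "(\<Sum>x\<in>b ` K. scale (f x) x) = 0" "x \<in> b ` K"
    then show "f x = 0"
      using inj indep[of "\<lambda>x. f (b x)"] by (auto simp: sum.reindex)
  qed (use assms in simp)
  then have "dim UNIV = card (b ` K)"
    using assms(3) by (intro dim_eq_card) simp_all
  then show ?thesis using inj by (simp add: card_image)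
qed

end

section \<open>Weight spaces and the dimension count\<close>

context so_weight_module
begin

text \<open>By the formulas on monomials the span is stable under \<open>low\<close>,
  \<open>raise\<close>, \<open>H\<close> and the \<open>E i j\<close> with indices in
  \<open>J\<close>. All other \<open>E i j\<close> are linear combinations of these, so
  irreducibility applies.\<close>

lemma span_mon: "span (mon ` {A. set_mset A \<subseteq> J}) = UNIV"
proof -
  let ?W = "span (mon ` {A. set_mset A \<subseteq> J})"
  have mon_W: "mon A \<in> ?W" if "set_mset A \<subseteq> J" for A
    using that by (auto intro: span_base)
  have stable: "f w \<in> ?W" if f: "module_hom scale scale f"
    and fA: "\<And>A. set_mset A \<subseteq> J \<Longrightarrow> f (mon A) \<in> ?W" and w: "w \<in> ?W" for f w
    using w
  proof (induction rule: span_induct_alt)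
    case base
    show ?case by (simp add: module_hom.zero[OF f] span_zero)
  next
    case (step c x y)
    then show ?case
      using fA by (auto simp: module_hom.add[OF f] module_hom.scale[OF f] intro: span_add span_scale)
  qed
  have low_W: "low j w \<in> ?W" if "w \<in> ?W" "j \<in> J" for j w
    by (rule stable[OF low_hom _ that(1)]) (use mon_W that in \<open>auto simp flip: mon_add simp del: mon_add\<close>)
  have D_W: "D j A \<in> ?W" if "set_mset A \<subseteq> J" for j A
    unfolding D_def by (intro span_scale mon_W) (use that in \<open>auto dest: in_diffD\<close>)
  have D2_W: "D2 j A \<in> ?W" if "set_mset A \<subseteq> J" for j A
    unfolding D2_def by (intro span_scale D_W) (use that in \<open>auto dest: in_diffD\<close>)
  have H_W: "H w \<in> ?W" if "w \<in> ?W" for w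
    by (rule stable[OF weight_op_hom _ that]) (auto simp: H_mon intro: span_scale mon_W)
  have raise_W: "raise p q j w \<in> ?W" if "w \<in> ?W" "j \<in> J" for j w
    by (rule stable[OF raise_hom _ that(1)])
      (auto simp: raise_mon that intro!: span_diff span_neg span_scale low_W D_W span_sum D2_W)
  have E_W: "E i j w \<in> ?W" if "w \<in> ?W" "i \<in> J" "j \<in> J" for i j w
    by (rule stable[OF E_hom _ that(1)])
      (auto simp: E_mon that intro!: span_diff low_W D_W)
  have Epq: "E p q w \<in> ?W" if "w \<in> ?W" for w
  proof -
    have "E p q w = \<i> *s H w" by (simp add: weight_op_def)
    then show ?thesis using H_W that by (auto intro: span_scale)
  qed
  have Epj: "E p j w \<in> ?W" if "w \<in> ?W" "j \<in> J" for j w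
  proof -
    have "raise p q j w + low j w = 2 *s E p j w"
      using that by (simp add: low_def raise_def lower_def double)
    then have "E p j w = (1 / 2) *s (raise p q j w + low j w)" by simp
    then show ?thesis by (simp only: span_scale span_add raise_W low_W that)
  qed
  have Eqj: "E q j w \<in> ?W" if "w \<in> ?W" "j \<in> J" for j w
  proof -
    have "E q j w = (- \<i>) *s (raise p q j w - E p j w)"
      by (simp add: raise_def)
    then show ?thesis by (simp only: span_scale span_diff raise_W Epj that)
  qed
  have "?W = {0} \<or> ?W = UNIV"
  proof (rule irreducible)
    fix i j w assume ij: "i \<in> I" "j \<in> I" and w: "w \<in> ?W"
    consider "i = j" | "i = p" "j = q" | "i = q" "j = p" | "i = p" "j \<in> J" | "i = q" "j \<in> J"
      | "i \<in> J" "j = p" | "i \<in> J" "j = q" | "i \<in> J" "j \<in> J"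
      using ij by (auto simp: J_def)
    then show "E i j w \<in> ?W"
      using Epq[OF w] Epj[OF w] Eqj[OF w] E_W[OF w] span_neg span_zero
      by cases (auto simp: E_diag E_antisym[of q p] E_antisym[of i p] E_antisym[of i q])
  qed (rule subspace_span)
  moreover have "v \<in> ?W" using mon_W[of "{#}"] by simp
  ultimately show ?thesis using v_nonzero by auto
qed

lemma weight_decomposition:
  "\<exists>u K. w = (\<Sum>k<K. u k) \<and> (\<forall>k. u k \<in> span (mon ` multisets_of_size J k))"
proof -
  have "w \<in> span (mon ` {A. set_mset A \<subseteq> J})" by (simp add: span_mon)
  then show ?thesis
  proof (induction rule: span_induct_alt)
    case base
    show ?case by (intro exI[of _ "\<lambda>_. 0"] exI[of _ 0]) (simp add: span_zero)
  next
    case (step c x y)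
    then obtain A u K where A: "x = mon A" "set_mset A \<subseteq> J"
      and u: "y = (\<Sum>k<K. u k)" "\<And>k. u k \<in> span (mon ` multisets_of_size J k)" by auto
    \<comment> \<open>Entries of \<open>u\<close> from \<open>K\<close> on do not occur in the sum,
      so they are cut off before the range grows.\<close>
    let ?u = "\<lambda>k. (if k = size A then c *s mon A else 0) + (if k < K then u k else 0)"
    let ?K = "max K (Suc (size A))"
    have "(\<Sum>k<?K. if k < K then u k else 0) = (\<Sum>k<K. u k)"
      by (rule sum.mono_neutral_cong_right) auto
    then have "c *s x + y = (\<Sum>k<?K. ?u k)"
      by (simp add: sum.distrib A u(1) less_max_iff_disj)
    moreover have "\<forall>k. ?u k \<in> span (mon ` multisets_of_size J k)"
      using A u(2)
      by (auto intro!: span_add span_scale intro: span_base simp: span_zero multisets_of_size_def)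
    ultimately show ?case by blast
  qed
qed

lemma H_span_mon:
  assumes "u \<in> span (mon ` multisets_of_size J k)"
  shows "H u = (of_nat t - of_nat k) *s u"
  using assms
proof (induction rule: span_induct_alt)
  case base
  show ?case by (simp add: module_hom.zero[OF weight_op_hom])
next
  case (step c x y)
  then show ?case
    by (auto simp: module_hom.add[OF weight_op_hom] module_hom.scale[OF weight_op_hom] H_mon
        multisets_of_size_def scale_right_distrib mult.commute)
qed

text \<open>Applying \<open>H\<close> minus \<open>z\<close> to the decomposition into homogeneous
  parts kills each part separately, so only the part whose own eigenvalue is \<open>z\<close> can
  survive.\<close>

lemma eigenvector_cases:
  assumes "H w = z *s w"
  shows "w = 0 \<or> (\<exists>k. z = of_nat t - of_nat k \<and> w \<in> span (mon ` multisets_of_size J k))"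
proof (rule ccontr)
  assume not: "\<not> ?thesis"
  obtain u K where u: "w = (\<Sum>k<K. u k)" "\<And>k. u k \<in> span (mon ` multisets_of_size J k)"
    using weight_decomposition by blast
  let ?e = "\<lambda>k. of_nat t - of_nat k :: complex"
  have "(\<Sum>k<K. (?e k - z) *s u k) = H w - z *s w"
    unfolding u(1) module_hom.sum[OF weight_op_hom]
    by (simp add: H_span_mon[OF u(2)] scale_left_diff_distrib sum_subtractf scale_sum_right)
  then have sum0: "(\<Sum>k<K. (?e k - z) *s u k) = 0" using assms by simp
  have *: "(?e k - z) *s u k = 0" if "k < K" for k
    by (rule eigenvector_sum_zero[OF weight_op_hom[of p q] _ _ _ sum0, where \<mu> = ?e])
      (use that in \<open>auto simp: inj_on_def module_hom.scale[OF weight_op_hom] H_span_mon[OF u(2)]\<close>)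
  have "u k = 0" if "k < K" "?e k \<noteq> z" for k
    using *[OF that(1)] that(2) by simp
  moreover have "\<exists>k<K. u k \<noteq> 0" using not u(1) by (meson lessThan_iff sum.neutral)
  ultimately obtain k where k: "k < K" "?e k = z" by auto
  then have "u l = 0" if "l < K" "l \<noteq> k" for l
    using *[OF that(1)] that(2) by auto
  then have "w = (\<Sum>l\<in>{k}. u l)"
    unfolding u(1) by (intro sum.mono_neutral_right) (use k in auto)
  then have "w \<in> span (mon ` multisets_of_size J k)" using u(2) by simp
  then show False using not k by auto
qed

lemma eigenvector_top:
  assumes "s \<ge> Suc t" "H u = of_nat s *s u"
  shows "u = 0"
proof (rule ccontr)
  assume "u \<noteq> 0"
  then obtain k where "(of_nat s :: complex) = of_nat t - of_nat k"
    using eigenvector_cases[OF assms(2)] by auto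
  then have "s + k = t" by (metis diff_add_cancel of_nat_add of_nat_eq_iff)
  then show False using assms(1) by simp
qed

lemma eigenvector_bottom: "\<exists>K. \<forall>s\<ge>K. \<forall>u. H u = (- of_nat s) *s u \<longrightarrow> u = 0"
proof -
  obtain B where B: "finite B" "span B = UNIV" using finite_dim by blast
  define P where "P s u \<longleftrightarrow> u \<noteq> 0 \<and> H u = (- of_nat s) *s u" for s u
  \<comment> \<open>The default 0 makes \<open>f s\<close> satisfy the eigenvector equation for
    every \<open>s\<close>.\<close>
  define f where "f s = (if \<exists>u. P s u then SOME u. P s u else 0)" for s
  have f: "\<exists>u. P s u \<Longrightarrow> P s (f s)" for s by (auto simp: f_def intro: someI)
  have "H (f s) = (- of_nat s) *s f s" for s
    using f[of s] by (cases "\<exists>u. P s u") (auto simp: P_def f_def module_hom.zero[OF weight_op_hom])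
  then have "finite {s. f s \<noteq> 0}"
    by (rule finite_nonzero_eigenvectors[OF weight_op_hom _ _ B, rotated]) (auto simp: inj_def)
  then obtain K where "\<forall>s\<in>{s. f s \<noteq> 0}. s < K" using finite_nat_set_iff_bounded by blast
  then have "\<forall>s\<ge>K. f s = 0" by auto
  then show ?thesis using f by (metis P_def)
qed

text \<open>A basis is formed by the monomials of degree at most \<open>t\<close>, whose weights are
  nonnegative, and the mirror images of those of degree less than \<open>t\<close>. Weight 0 is its
  own mirror image, hence the strict bound in the second sum.\<close>

lemma dim_UNIV_eq:
  "dim (UNIV :: 'm set) =
    (\<Sum>k\<le>t. card (multisets_of_size J k)) + (\<Sum>k<t. card (multisets_of_size J k))"
proof -
  obtain j0 where j0: "j0 \<in> J" using J_ne by blast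
  define F where "F m = - lower p q j0 m" for m
  interpret sl2: sl2_operators scale "raise p q j0" F H
    unfolding F_def[abs_def] by (rule sl2) (use j0 pq in \<open>auto simp: J_def\<close>)
  have F_power: "module_hom scale scale (F ^^ k)" for k
    by (rule module_hom_selfI) (simp_all add: sl2.F_power_add sl2.F_power_scale)
  define A1 where "A1 = (\<Union>k\<le>t. multisets_of_size J k)"
  define A2 where "A2 = (\<Union>k<t. multisets_of_size J k)"
  \<comment> \<open>The exponent carries weight \<open>t - size A\<close> to its negative.\<close>
  define b where "b x = (case x of Inl A \<Rightarrow> mon A | Inr A \<Rightarrow> (F ^^ (2 * (t - size A))) (mon A))" for x
  define wt :: "'i multiset + 'i multiset \<Rightarrow> int"
    where "wt x = (case x of Inl A \<Rightarrow> int t - int (size A) | Inr A \<Rightarrow> int (size A) - int t)" for x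
  let ?K = "A1 <+> A2"
  have fin: "finite A1" "finite A2" using finite_J by (auto simp: A1_def A2_def)
  have A: "A \<in> A1 \<longleftrightarrow> set_mset A \<subseteq> J \<and> size A \<le> t" "A \<in> A2 \<longleftrightarrow> set_mset A \<subseteq> J \<and> size A < t" for A
    by (auto simp: A1_def A2_def multisets_of_size_def)
  have Hb: "H (b x) = of_int (wt x) *s b x" if "x \<in> ?K" for x
  proof (cases x)
    case (Inl A)
    then show ?thesis using that A by (auto simp: b_def wt_def H_mon)
  next
    case (Inr B)
    then have B: "set_mset B \<subseteq> J" "size B < t" using that A by auto
    have "(of_nat t - of_nat (size B) - of_nat (2 * (t - size B)) :: complex) = of_int (wt x)"
      using B by (simp add: Inr wt_def of_nat_diff)
    then show ?thesis
      using sl2.H_F_power[OF H_mon[OF B(1)], of "2 * (t - size B)"] by (simp add: Inr b_def)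
  qed
  have indep: "c x = 0" if c: "(\<Sum>x\<in>?K. c x *s b x) = 0" and x: "x \<in> ?K" for c x
  proof -
    \<comment> \<open>A relation splits into its weight components; each involves only monomials of
      one degree, or only the mirror images of such monomials.\<close>
    let ?S = "\<lambda>w. \<Sum>y\<in>{y \<in> ?K. wt y = w}. c y *s b y"
    have "(\<Sum>w\<in>wt ` ?K. ?S w) = 0"
      using fin c by (subst sum.group) auto
    moreover have "H (?S w) = of_int w *s ?S w" for w
      unfolding module_hom.sum[OF weight_op_hom] scale_sum_right
      by (intro sum.cong refl) (auto simp: module_hom.scale[OF weight_op_hom] Hb mult.commute)
    ultimately have S: "?S (wt x) = 0"
      by (intro eigenvector_sum_zero[OF weight_op_hom[of p q], where \<mu> = of_int and I = "wt ` ?K" and u = ?S])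
        (use fin x in \<open>auto simp: inj_on_def\<close>)
    show ?thesis
    proof (cases x)
      case (Inl A)
      then have k: "size A \<le> t" "A \<in> multisets_of_size J (size A)"
        using x A by (auto simp: multisets_of_size_def)
      have "{y \<in> ?K. wt y = wt x} = Inl ` multisets_of_size J (size A)"
        using k by (auto simp: A Inl wt_def multisets_of_size_def)
      then have "(\<Sum>A\<in>multisets_of_size J (size A). c (Inl A) *s mon A) = 0"
        using S by (simp add: sum.reindex b_def)
      then show ?thesis using mon_coeff_zero[OF k(1) _ k(2), of "\<lambda>A. c (Inl A)"] Inl by simp
    next
      case (Inr A)
      then have k: "size A < t" "A \<in> multisets_of_size J (size A)"
        using x A by (auto simp: multisets_of_size_def)
      have "{y \<in> ?K. wt y = wt x} = Inr ` multisets_of_size J (size A)"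
        using k by (auto simp: A Inr wt_def multisets_of_size_def)
      then have "(\<Sum>B\<in>multisets_of_size J (size A). c (Inr B) *s (F ^^ (2 * (t - size A))) (mon B)) = 0"
        using S by (simp add: sum.reindex b_def multisets_of_size_def)
      then have F0: "(F ^^ (2 * (t - size A))) (\<Sum>B\<in>multisets_of_size J (size A). c (Inr B) *s mon B) = 0"
        by (simp add: module_hom.sum[OF F_power] module_hom.scale[OF F_power])
      have "(\<Sum>B\<in>multisets_of_size J (size A). c (Inr B) *s mon B)
          \<in> span (mon ` multisets_of_size J (size A))"
        by (intro span_sum span_scale span_base imageI)
      then have "(\<Sum>B\<in>multisets_of_size J (size A). c (Inr B) *s mon B) = 0"
        using H_span_mon k(1)
        by (intro sl2.F_power_inj[OF eigenvector_top _ F0]) (auto simp: of_nat_diff)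
      then show ?thesis using mon_coeff_zero[OF _ _ k(2), of "\<lambda>B. c (Inr B)"] k Inr by simp
    qed
  qed
  have span: "span (b ` ?K) = UNIV"
  proof -
    have "mon A \<in> span (b ` ?K)" if A_J: "set_mset A \<subseteq> J" for A
    proof (cases "size A \<le> t")
      case True
      then have "Inl A \<in> ?K" using A_J A by auto
      then have "b (Inl A) \<in> span (b ` ?K)" by (intro span_base imageI)
      then show ?thesis by (simp add: b_def)
    next
      case False
      \<comment> \<open>Beyond degree \<open>t\<close> the weight is \<open>- s\<close> with
        \<open>s\<close> positive. So the monomial is the image of a vector of weight
        \<open>s\<close>, which is a combination of monomials of degree
        \<open>t - s\<close>.\<close>
      define s where "s = size A - t"
      have HA: "H (mon A) = (- of_nat s) *s mon A"
        using False by (simp add: H_mon[OF A_J] s_def of_nat_diff)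
      obtain L where "\<And>s u. s \<ge> L \<Longrightarrow> H u = (- of_nat s) *s u \<Longrightarrow> u = 0"
        using eigenvector_bottom by blast
      then obtain w where w: "H w = of_nat s *s w" "(F ^^ (2 * s)) w = mon A"
        using sl2.F_power_surj[OF _ HA] by blast
      from eigenvector_cases[OF w(1)] show ?thesis
      proof (elim disjE exE conjE)
        assume "w = 0"
        then show ?thesis by (simp add: sl2.F_power_0 span_zero flip: w(2))
      next
        fix k assume "(of_nat s :: complex) = of_nat t - of_nat k"
          and w_k: "w \<in> span (mon ` multisets_of_size J k)"
        then have "s + k = t" by (metis diff_add_cancel of_nat_add of_nat_eq_iff)
        with False have k: "k < t" "t - k = s" by (auto simp: s_def)
        have "mon A \<in> (F ^^ (2 * s)) ` span (mon ` multisets_of_size J k)"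
          using w_k by (simp flip: w(2))
        also have "\<dots> = span ((F ^^ (2 * s)) ` mon ` multisets_of_size J k)"
          by (rule module_hom.span_image[OF F_power, symmetric])
        finally have "mon A \<in> span ((F ^^ (2 * s)) ` mon ` multisets_of_size J k)" .
        moreover have "(F ^^ (2 * s)) ` mon ` multisets_of_size J k \<subseteq> b ` ?K"
        proof clarify
          fix B assume "B \<in> multisets_of_size J k"
          then have "Inr B \<in> ?K" "b (Inr B) = (F ^^ (2 * s)) (mon B)"
            using k by (auto simp: A b_def multisets_of_size_def)
          then show "(F ^^ (2 * s)) (mon B) \<in> b ` ?K" by (metis imageI)
        qed
        ultimately show ?thesis using span_mono by blast
      qed
    qed
    then have "mon ` {A. set_mset A \<subseteq> J} \<subseteq> span (b ` ?K)" by auto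
    then show ?thesis using span_mon span_minimal[OF _ subspace_span] by blast
  qed
  have "dim (UNIV :: 'm set) = card ?K"
  proof (rule dim_UNIV_family)
    show "finite ?K" using fin by simp
    show "c x = 0" if "(\<Sum>x\<in>?K. c x *s b x) = 0" "x \<in> ?K" for c x
      using that by (rule indep)
  qed (rule span)
  also have "\<dots> = card A1 + card A2" using fin by (simp add: card_Plus)
  also have "card A1 = (\<Sum>k\<le>t. card (multisets_of_size J k))"
    unfolding A1_def using finite_J
    by (intro card_UN_disjoint) (auto dest!: multisets_of_size_size)
  also have "card A2 = (\<Sum>k<t. card (multisets_of_size J k))"
    unfolding A2_def using finite_J
    by (intro card_UN_disjoint) (auto dest!: multisets_of_size_size)
  finally show ?thesis .
qed

end

section \<open>Representations of the orthogonal Lie algebra\<close>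

text \<open>The index \<open>i\<close> is 1-based as in \<open>so_basis\<close>, the argument
  \<open>r\<close> 0-based as for matrix entries.\<close>

definition unit_fun :: "nat \<Rightarrow> nat \<Rightarrow> complex" where
  "unit_fun i r = (if Suc r = i then 1 else 0)"

text \<open>The skew matrix of the bivector of \<open>u\<close> and \<open>w\<close>. Being bilinear
  in them, it covers root vectors as well as the basis elements.\<close>

definition so_wedge :: "nat \<Rightarrow> (nat \<Rightarrow> complex) \<Rightarrow> (nat \<Rightarrow> complex) \<Rightarrow> complex mat" where
  "so_wedge N u w = mat N N (\<lambda>(r, c). u r * w c - w r * u c)"

definition dot :: "nat \<Rightarrow> (nat \<Rightarrow> complex) \<Rightarrow> (nat \<Rightarrow> complex) \<Rightarrow> complex" where
  "dot N u w = (\<Sum>r<N. u r * w r)"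

lemma so_wedge_carrier [simp]: "so_wedge N u w \<in> carrier_mat N N"
  and so_wedge_dim [simp]: "dim_row (so_wedge N u w) = N" "dim_col (so_wedge N u w) = N"
  and so_wedge_index [simp]: "r < N \<Longrightarrow> c < N \<Longrightarrow> so_wedge N u w $$ (r, c) = u r * w c - w r * u c"
  by (simp_all add: so_wedge_def)

lemma so_wedge_in_so [simp]: "so_wedge N u w \<in> so N"
  by (auto simp: so_def intro!: eq_matI)

lemma so_add: "X \<in> so N \<Longrightarrow> Y \<in> so N \<Longrightarrow> X + Y \<in> so N"
  by (auto simp: so_def transpose_add intro!: eq_matI)

lemma so_smult: "X \<in> so N \<Longrightarrow> c \<cdot>\<^sub>m X \<in> so N"
  by (auto simp: so_def intro!: eq_matI) (metis carrier_matD index_smult_mat(1) index_transpose_mat(1)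
      index_uminus_mat(1) mult_minus_right)

lemma so_basis_eq_so_wedge: "i \<noteq> j \<Longrightarrow> so_basis N i j = so_wedge N (unit_fun i) (unit_fun j)"
  by (rule eq_matI) (auto simp: so_basis_def unit_fun_def)

lemma dot_unit_left: "i \<in> {1..N} \<Longrightarrow> dot N (unit_fun i) w = w (i - 1)"
proof -
  assume i: "i \<in> {1..N}"
  have "dot N (unit_fun i) w = (\<Sum>r<N. if r = i - 1 then w r else 0)"
    unfolding dot_def by (rule sum.cong) (use i in \<open>auto simp: unit_fun_def\<close>)
  moreover have "i - 1 < N" using i by auto
  ultimately show ?thesis by simp
qed

lemma so_wedge_mult_index:
  assumes "r < N" "c < N"
  shows "(so_wedge N u w * so_wedge N x y) $$ (r, c) =
    u r * y c * dot N w x - u r * x c * dot N w y - w r * y c * dot N u x + w r * x c * dot N u y"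
proof -
  have "(so_wedge N u w * so_wedge N x y) $$ (r, c) =
      (\<Sum>q<N. (u r * w q - w r * u q) * (x q * y c - y q * x c))"
    using assms by (simp add: scalar_prod_def lessThan_atLeast0)
  also have "\<dots> = (\<Sum>q<N. u r * y c * (w q * x q) - u r * x c * (w q * y q)
      - w r * y c * (u q * x q) + w r * x c * (u q * y q))"
    by (rule sum.cong) (simp_all add: algebra_simps)
  also have "\<dots> = u r * y c * dot N w x - u r * x c * dot N w y
      - w r * y c * dot N u x + w r * x c * dot N u y"
    by (simp add: dot_def sum.distrib sum_subtractf sum_distrib_left)
  finally show ?thesis .
qed

lemma dot_commute: "dot N u w = dot N w u"
  by (simp add: dot_def mult.commute)

lemma commutator_so_wedge_index:
  assumes "r < N" "c < N"
  shows "commutator (so_wedge N u w) (so_wedge N x y) $$ (r, c) =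
    dot N w x * (u r * y c - y r * u c) - dot N w y * (u r * x c - x r * u c)
    - dot N u x * (w r * y c - y r * w c) + dot N u y * (w r * x c - x r * w c)"
proof -
  have "commutator (so_wedge N u w) (so_wedge N x y) $$ (r, c) =
      (so_wedge N u w * so_wedge N x y) $$ (r, c) - (so_wedge N x y * so_wedge N u w) $$ (r, c)"
    unfolding commutator_def using assms by (intro index_minus_mat) auto
  then show ?thesis
    unfolding so_wedge_mult_index[OF assms]
    by (simp add: dot_commute[of N x] dot_commute[of N y] algebra_simps)
qed

lemma commutator_so_wedge_dim [simp]:
  "dim_row (commutator (so_wedge N u w) (so_wedge N x y)) = N"
  "dim_col (commutator (so_wedge N u w) (so_wedge N x y)) = N"
  by (simp_all add: commutator_def)

lemma commutator_so_wedge: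
  "commutator (so_wedge N u w) (so_wedge N x y) =
    (dot N w x \<cdot>\<^sub>m so_wedge N u y + (- dot N u x) \<cdot>\<^sub>m so_wedge N w y) +
    ((- dot N w y) \<cdot>\<^sub>m so_wedge N u x + dot N u y \<cdot>\<^sub>m so_wedge N w x)"
  by (rule eq_matI) (simp_all add: commutator_so_wedge_index)

text \<open>The matrix of \<open>u\<close> and \<open>w\<close> sends a vector a to (w.a) u - (u.a)
  w and acts on bivectors as a derivation, so eigenvalues add.\<close>

lemma commutator_so_wedge_eigenvectors:
  assumes "\<And>r. r < N \<Longrightarrow> dot N w a * u r - dot N u a * w r = \<mu> * a r"
    and "\<And>r. r < N \<Longrightarrow> dot N w b * u r - dot N u b * w r = \<nu> * b r"
  shows "commutator (so_wedge N u w) (so_wedge N a b) = (\<mu> + \<nu>) \<cdot>\<^sub>m so_wedge N a b"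
proof (rule eq_matI)
  fix r c assume "r < dim_row ((\<mu> + \<nu>) \<cdot>\<^sub>m so_wedge N a b)" "c < dim_col ((\<mu> + \<nu>) \<cdot>\<^sub>m so_wedge N a b)"
  then have rc: "r < N" "c < N" by auto
  have "commutator (so_wedge N u w) (so_wedge N a b) $$ (r, c) =
      (dot N w a * u r - dot N u a * w r) * b c + a r * (dot N w b * u c - dot N u b * w c)
      - b r * (dot N w a * u c - dot N u a * w c) - (dot N w b * u r - dot N u b * w r) * a c"
    unfolding commutator_so_wedge_index[OF rc] by (simp add: algebra_simps)
  also have "\<dots> = (\<mu> * a r) * b c + a r * (\<nu> * b c) - b r * (\<mu> * a c) - (\<nu> * b r) * a c"
    by (simp only: assms rc)
  finally show "commutator (so_wedge N u w) (so_wedge N a b) $$ (r, c) = ((\<mu> + \<nu>) \<cdot>\<^sub>m so_wedge N a b) $$ (r, c)"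
    using rc by (simp add: algebra_simps)
qed simp_all

lemma so_cartan_eq_so_wedge:
  "1 \<le> k \<Longrightarrow> so_cartan N k = so_wedge N (\<lambda>r. - \<i> * unit_fun (2 * k - 1) r) (unit_fun (2 * k))"
  by (rule eq_matI) (auto simp: so_cartan_def so_basis_eq_so_wedge algebra_simps)

text \<open>For \<open>c = \<i>\<close> and \<open>c = - \<i>\<close> these are the vectors of
  weight \<open>\<epsilon> a\<close> and its negative in the standard representation.\<close>

definition isotropic :: "complex \<Rightarrow> nat \<Rightarrow> nat \<Rightarrow> complex" where
  "isotropic c a r = unit_fun (2 * a - 1) r + c * unit_fun (2 * a) r"

lemma dot_scale_left: "dot N (\<lambda>r. c * u r) x = c * dot N u x"
  by (simp add: dot_def sum_distrib_left mult_ac)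

lemma cartan_eigenvector_isotropic:
  assumes "k \<in> {1..N div 2}" "a \<in> {1..N div 2}" and c: "c = \<i> \<and> \<delta> = 1 \<or> c = - \<i> \<and> \<delta> = - 1"
  shows "dot N (unit_fun (2 * k)) (isotropic c a) * (- \<i> * unit_fun (2 * k - 1) r)
      - dot N (\<lambda>r. - \<i> * unit_fun (2 * k - 1) r) (isotropic c a) * unit_fun (2 * k) r
    = \<delta> * \<epsilon> a k * isotropic c a r"
proof -
  have ka: "1 \<le> k" "1 \<le> a" "2 * k \<in> {1..N}" "2 * k - 1 \<in> {1..N}" using assms(1,2) by auto
  have ne: "2 * k \<noteq> 2 * a - 1" "2 * k - 1 \<noteq> 2 * a" "2 * k - 1 = 2 * a - 1 \<longleftrightarrow> k = a"
    "Suc (2 * k - 1) = 2 * k" "Suc (2 * k - 1 - 1) = 2 * k - 1"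
    using ka by presburger+
  have 1: "dot N (unit_fun (2 * k)) (isotropic c a) = c * \<epsilon> a k"
    unfolding dot_unit_left[OF ka(3)] isotropic_def unit_fun_def ne \<epsilon>_def using ne(1) by simp
  have 2: "dot N (unit_fun (2 * k - 1)) (isotropic c a) = \<epsilon> a k"
    unfolding dot_unit_left[OF ka(4)] isotropic_def unit_fun_def ne \<epsilon>_def using ne(2) by simp
  show ?thesis
    unfolding dot_scale_left 1 2
    using c by (cases "k = a") (auto simp: \<epsilon>_def isotropic_def algebra_simps)
qed

text \<open>For odd \<open>N\<close> the last coordinate lies outside all the Cartan planes.\<close>

lemma cartan_eigenvector_last:
  assumes "k \<in> {1..N div 2}" "odd N"
  shows "dot N (unit_fun (2 * k)) (unit_fun N) * (- \<i> * unit_fun (2 * k - 1) r)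
      - dot N (\<lambda>r. - \<i> * unit_fun (2 * k - 1) r) (unit_fun N) * unit_fun (2 * k) r
    = 0 * unit_fun N r"
proof -
  have 1: "dot N (unit_fun (2 * k)) (unit_fun N) = 0"
    using assms by (subst dot_unit_left) (auto simp: unit_fun_def)
  have 2: "dot N (unit_fun (2 * k - 1)) (unit_fun N) = 0"
    using assms by (subst dot_unit_left) (auto simp: unit_fun_def; presburger)+
  show ?thesis unfolding dot_scale_left 1 2 by simp
qed

lemma isotropic_root_space:
  assumes ab: "a \<in> {1..N div 2}" "b \<in> {1..N div 2}" and c: "c = \<i> \<and> \<delta> = 1 \<or> c = - \<i> \<and> \<delta> = - 1"
  shows "so_wedge N (isotropic \<i> a) (isotropic c b) \<in> so_root_space N (\<lambda>k. \<epsilon> a k + \<delta> * \<epsilon> b k)"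
  unfolding so_root_space_def
proof (intro CollectI conjI ballI)
  fix k assume k: "k \<in> {1..N div 2}"
  then have k1: "1 \<le> k" by simp
  have "commutator (so_cartan N k) (so_wedge N (isotropic \<i> a) (isotropic c b)) =
      (1 * \<epsilon> a k + \<delta> * \<epsilon> b k) \<cdot>\<^sub>m so_wedge N (isotropic \<i> a) (isotropic c b)"
    unfolding so_cartan_eq_so_wedge[OF k1]
    by (intro commutator_so_wedge_eigenvectors cartan_eigenvector_isotropic[OF k ab(1)]
        cartan_eigenvector_isotropic[OF k ab(2) c]) simp
  then show "commutator (so_cartan N k) (so_wedge N (isotropic \<i> a) (isotropic c b)) =
      (\<epsilon> a k + \<delta> * \<epsilon> b k) \<cdot>\<^sub>m so_wedge N (isotropic \<i> a) (isotropic c b)" by simp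
qed simp

lemma isotropic_last_root_space:
  assumes a: "a \<in> {1..N div 2}" and N: "odd N"
  shows "so_wedge N (isotropic \<i> a) (unit_fun N) \<in> so_root_space N (\<epsilon> a)"
  unfolding so_root_space_def
proof (intro CollectI conjI ballI)
  fix k assume k: "k \<in> {1..N div 2}"
  then have k1: "1 \<le> k" by simp
  have "commutator (so_cartan N k) (so_wedge N (isotropic \<i> a) (unit_fun N)) =
      (1 * \<epsilon> a k + 0) \<cdot>\<^sub>m so_wedge N (isotropic \<i> a) (unit_fun N)"
    unfolding so_cartan_eq_so_wedge[OF k1]
    by (intro commutator_so_wedge_eigenvectors cartan_eigenvector_isotropic[OF k a]
        cartan_eigenvector_last[OF k N]) simp
  then show "commutator (so_cartan N k) (so_wedge N (isotropic \<i> a) (unit_fun N)) =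
      \<epsilon> a k \<cdot>\<^sub>m so_wedge N (isotropic \<i> a) (unit_fun N)" by simp
qed simp

section \<open>From matrices to operators\<close>

locale so_representation = vector_space s
  for s :: "complex \<Rightarrow> 'm::ab_group_add \<Rightarrow> 'm" (infixr "*s" 75) +
  fixes N :: nat and \<sigma> :: "complex mat \<Rightarrow> 'm \<Rightarrow> 'm"
  assumes rep: "lie_representation (so N) s UNIV \<sigma>"
begin

definition T :: "(nat \<Rightarrow> complex) \<Rightarrow> (nat \<Rightarrow> complex) \<Rightarrow> 'm \<Rightarrow> 'm" where
  "T u w = \<sigma> (so_wedge N u w)"

lemma \<sigma>_add: "X \<in> so N \<Longrightarrow> Y \<in> so N \<Longrightarrow> \<sigma> (X + Y) m = \<sigma> X m + \<sigma> Y m"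
  and \<sigma>_smult: "X \<in> so N \<Longrightarrow> \<sigma> (c \<cdot>\<^sub>m X) m = c *s \<sigma> X m"
  and \<sigma>_commutator: "X \<in> so N \<Longrightarrow> Y \<in> so N \<Longrightarrow> \<sigma> (commutator X Y) m = \<sigma> X (\<sigma> Y m) - \<sigma> Y (\<sigma> X m)"
  and \<sigma>_vec_add: "X \<in> so N \<Longrightarrow> \<sigma> X (m + m') = \<sigma> X m + \<sigma> X m'"
  and \<sigma>_vec_scale: "X \<in> so N \<Longrightarrow> \<sigma> X (c *s m) = c *s \<sigma> X m"
  using rep unfolding lie_representation_def by blast+

lemma T_hom: "module_hom s s (T u w)"
  by unfold_locales (simp_all add: T_def \<sigma>_vec_add \<sigma>_vec_scale)

lemma T_add_right: "T u (\<lambda>r. x r + c * y r) m = T u x m + c *s T u y m"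
proof -
  have "so_wedge N u (\<lambda>r. x r + c * y r) = so_wedge N u x + c \<cdot>\<^sub>m so_wedge N u y"
    by (rule eq_matI) (simp_all add: algebra_simps)
  then show ?thesis by (simp add: T_def \<sigma>_add \<sigma>_smult so_smult)
qed

lemma T_antisym: "T w u m = - T u w m"
proof -
  have "so_wedge N w u = (- 1) \<cdot>\<^sub>m so_wedge N u w"
    by (rule eq_matI) simp_all
  then show ?thesis by (simp add: T_def \<sigma>_smult)
qed

lemma T_self: "T u u m = 0"
proof -
  have "so_wedge N u u = 0 \<cdot>\<^sub>m so_wedge N u u"
    by (rule eq_matI) simp_all
  then have "T u u m = 0 *s T u u m" unfolding T_def by (metis \<sigma>_smult so_wedge_in_so)
  then show ?thesis by simp
qed

lemma T_zero_right: "T u (\<lambda>r. 0) m = 0"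
  using T_add_right[of u "\<lambda>r. 0" 1 "\<lambda>r. 0" m] by simp

lemma T_add_left: "T (\<lambda>r. x r + c * y r) w m = T x w m + c *s T y w m"
  using T_add_right[of w x c y m] by (simp add: T_antisym[of _ w])

lemma T_commutator:
  "T u w (T x y m) = T x y (T u w m) + dot N w x *s T u y m - dot N u x *s T w y m
    - dot N w y *s T u x m + dot N u y *s T w x m"
proof -
  have "T u w (T x y m) - T x y (T u w m) =
      \<sigma> (commutator (so_wedge N u w) (so_wedge N x y)) m"
    by (simp add: T_def \<sigma>_commutator)
  also have "\<dots> = dot N w x *s T u y m - dot N u x *s T w y m
      - dot N w y *s T u x m + dot N u y *s T w x m"
    unfolding commutator_so_wedge by (simp add: T_def \<sigma>_add \<sigma>_smult so_add so_smult)
  finally show ?thesis by (simp add: algebra_simps)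
qed

sublocale so_operators s "{1..N}" "\<lambda>i j. T (unit_fun i) (unit_fun j)"
proof (intro so_operators.intro so_operators_axioms.intro)
  show "vector_space s" by (rule vector_space_axioms)
  show "module_hom s s (T (unit_fun i) (unit_fun j))" for i j by (rule T_hom)
  show "T (unit_fun i) (unit_fun i) m = 0" for i m by (rule T_self)
  show "T (unit_fun j) (unit_fun i) m = - T (unit_fun i) (unit_fun j) m" for i j m by (rule T_antisym)
  have dot: "dot N (unit_fun i) (unit_fun j) = (if i = j then 1 else 0)"
    if "i \<in> {1..N}" "j \<in> {1..N}" for i j
    using that by (auto simp: dot_unit_left unit_fun_def)
  show "T (unit_fun i) (unit_fun j) (T (unit_fun k) (unit_fun l) m) =
      T (unit_fun k) (unit_fun l) (T (unit_fun i) (unit_fun j) m)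
      + (if j = k then T (unit_fun i) (unit_fun l) m else 0)
      - (if i = k then T (unit_fun j) (unit_fun l) m else 0)
      - (if j = l then T (unit_fun i) (unit_fun k) m else 0)
      + (if i = l then T (unit_fun j) (unit_fun k) m else 0)"
    if "i \<in> {1..N}" "j \<in> {1..N}" "k \<in> {1..N}" "l \<in> {1..N}" for i j k l m
    unfolding T_commutator[of "unit_fun i" "unit_fun j"] dot[OF that(1,3)] dot[OF that(1,4)]
      dot[OF that(2,3)] dot[OF that(2,4)] by simp
qed

lemma stable_T:
  assumes W: "subspace W"
    and E: "\<And>i j w. i \<in> {1..N} \<Longrightarrow> j \<in> {1..N} \<Longrightarrow> w \<in> W \<Longrightarrow> T (unit_fun i) (unit_fun j) w \<in> W"
    and i: "i \<in> {1..N}" and m: "m \<in> W"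
  shows "T (unit_fun i) x m \<in> W"
proof -
  \<comment> \<open>The coordinates of \<open>x\<close> are switched on one at a time; truncation at
    \<open>N\<close> does not change the matrix.\<close>
  have "n \<le> N \<Longrightarrow> T (unit_fun i) (\<lambda>r. if r < n then x r else 0) m \<in> W" for n
  proof (induction n)
    case 0
    then show ?case using subspace_0[OF W] by (simp add: T_zero_right)
  next
    case (Suc n)
    have "(\<lambda>r. if r < Suc n then x r else 0) =
        (\<lambda>r. (if r < n then x r else 0) + x n * unit_fun (Suc n) r)"
      by (auto simp: unit_fun_def less_Suc_eq)
    then show ?case
      using Suc E[OF i, of "Suc n" m] m W by (simp add: T_add_right subspace_add subspace_scale)
  qed
  moreover have "so_wedge N (unit_fun i) (\<lambda>r. if r < N then x r else 0) = so_wedge N (unit_fun i) x"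
    by (rule eq_matI) simp_all
  ultimately show ?thesis by (metis T_def order_refl)
qed

text \<open>A skew matrix is half the sum of the bivectors formed by the unit vectors and the
  corresponding rows; the \<open>Y n\<close> are the partial sums.\<close>

lemma stable_so:
  assumes W: "subspace W"
    and E: "\<And>i j w. i \<in> {1..N} \<Longrightarrow> j \<in> {1..N} \<Longrightarrow> w \<in> W \<Longrightarrow> T (unit_fun i) (unit_fun j) w \<in> W"
    and X: "X \<in> so N" and m: "m \<in> W"
  shows "\<sigma> X m \<in> W"
proof -
  define x where "x i c = X $$ (i, c) / 2" for i c
  define Y where "Y n = mat N N (\<lambda>(r, c). \<Sum>i<n. unit_fun (Suc i) r * x i c - x i r * unit_fun (Suc i) c)" for n
  have Y_so: "Y n \<in> so N" for n
    by (auto simp: Y_def so_def sum_negf[symmetric] mult.commute intro!: eq_matI)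
  have Y: "n \<le> N \<Longrightarrow> \<sigma> (Y n) m \<in> W" for n
  proof (induction n)
    case 0
    have "Y 0 = 0 \<cdot>\<^sub>m Y 0" by (rule eq_matI) (simp_all add: Y_def)
    then have "\<sigma> (Y 0) m = 0 *s \<sigma> (Y 0) m" by (metis \<sigma>_smult Y_so)
    then show ?case using subspace_0[OF W] by simp
  next
    case (Suc n)
    have "Y (Suc n) = Y n + so_wedge N (unit_fun (Suc n)) (x n)"
      by (rule eq_matI) (simp_all add: Y_def)
    then have "\<sigma> (Y (Suc n)) m = \<sigma> (Y n) m + T (unit_fun (Suc n)) (x n) m"
      by (simp add: \<sigma>_add Y_so T_def)
    then show ?case
      using Suc stable_T[OF W E, of "Suc n" m "x n"] m W by (simp add: subspace_add)
  qed
  have "X = Y N"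
  proof (rule eq_matI)
    have X': "X \<in> carrier_mat N N" "transpose_mat X = - X" using X by (auto simp: so_def)
    show "dim_row X = dim_row (Y N)" "dim_col X = dim_col (Y N)" using X' by (auto simp: Y_def)
    fix r c assume "r < dim_row (Y N)" "c < dim_col (Y N)"
    then have rc: "r < N" "c < N" by (auto simp: Y_def)
    have "transpose_mat X $$ (r, c) = X $$ (c, r)" "(- X) $$ (r, c) = - X $$ (r, c)"
      using X'(1) rc by auto
    then have anti: "X $$ (c, r) = - X $$ (r, c)" using X'(2) by simp
    have "Y N $$ (r, c) = (\<Sum>i<N. (if i = r then x i c else 0) - (if i = c then x i r else 0))"
      using rc unfolding Y_def by (auto simp: unit_fun_def intro!: sum.cong)
    also have "\<dots> = x r c - x c r" using rc by (simp add: sum_subtractf)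
    finally show "X $$ (r, c) = Y N $$ (r, c)" by (simp add: x_def anti)
  qed
  then show ?thesis using Y by simp
qed

section \<open>Consequences of a highest weight vector\<close>

context
  fixes t :: nat and v :: 'm
  assumes v: "so_highest_weight_vector N 0 s \<sigma> (\<lambda>k. of_nat t * so_first_fundamental_weight k) v"
begin

lemma weight_v:
  assumes "a \<in> {1..N div 2}"
  shows "weight_op (2 * a - 1) (2 * a) v = (if a = 1 then of_nat t else 0) *s v"
proof -
  have ne: "2 * a - 1 \<noteq> 2 * a" using assms by auto
  have "\<sigma> (so_cartan N a) v = (- \<i>) *s T (unit_fun (2 * a - 1)) (unit_fun (2 * a)) v"
    unfolding so_cartan_def so_basis_eq_so_wedge[OF ne] T_def by (rule \<sigma>_smult) simp
  moreover have "\<sigma> (so_cartan N a) v = (if a = 1 then of_nat t else 0) *s v"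
    using v assms by (auto simp: so_highest_weight_vector_def so_first_fundamental_weight_def \<epsilon>_def)
  ultimately show ?thesis by (simp only: weight_op_def)
qed

lemma positive_root_kills_v: "\<alpha> \<in> so_positive_roots N \<Longrightarrow> X \<in> so_root_space N \<alpha> \<Longrightarrow> \<sigma> X v = 0"
  using v unfolding so_highest_weight_vector_def by blast

text \<open>For \<open>j\<close> in a later pair \<open>2 * b - 1\<close>, \<open>2 * b\<close>, the
  root vectors for \<open>\<epsilon> a + \<epsilon> b\<close> and
  \<open>\<epsilon> a - \<epsilon> b\<close> both kill \<open>v\<close>, and combining the two
  equations isolates each index. An unpaired last index is covered by the root
  \<open>\<epsilon> a\<close>.\<close>

lemma raise_v:
  assumes a: "a \<in> {1..N div 2}" and j: "2 * a < j" "j \<le> N"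
  shows "raise (2 * a - 1) (2 * a) j v = 0"
proof -
  have raise: "raise (2 * a - 1) (2 * a) k v = T (isotropic \<i> a) (unit_fun k) v" for k
    unfolding raise_def isotropic_def[abs_def] T_add_left ..
  show ?thesis
  proof (cases "j = N \<and> odd N")
    case True
    moreover have "\<epsilon> a \<in> so_positive_roots N"
      using a True by (auto simp: so_positive_roots_def)
    ultimately have "T (isotropic \<i> a) (unit_fun N) v = 0"
      using isotropic_last_root_space[OF a] by (auto simp: T_def intro: positive_root_kills_v)
    then show ?thesis using True unfolding raise by simp
  next
    case False
    obtain b where b: "b \<in> {1..N div 2}" "a < b" "j = 2 * b - 1 \<or> j = 2 * b"
    proof (cases "even j")
      case True
      then obtain k where "j = 2 * k" by (elim evenE)
      then show ?thesis using that[of k] j by auto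
    next
      case odd: False
      then obtain k where k: "j = 2 * k + 1" by (elim oddE)
      have "j \<noteq> N" using False odd by auto
      then have "2 * (k + 1) \<le> N" using k j by simp
      then have "k + 1 \<le> N div 2" using div_le_mono[of "2 * (k + 1)" N 2] by simp
      then show ?thesis using that[of "k + 1"] j k by simp
    qed
    have ab: "1 \<le> a" "b \<le> N div 2" using a b(1) by auto
    have "(\<lambda>k. \<epsilon> a k + \<epsilon> b k) \<in> so_positive_roots N"
      unfolding so_positive_roots_def
      by (intro UnI1 CollectI exI[of _ a] exI[of _ b] conjI disjI2 refl ab b(2))
    moreover have "(\<lambda>k. \<epsilon> a k - \<epsilon> b k) \<in> so_positive_roots N"
      unfolding so_positive_roots_def
      by (intro UnI1 CollectI exI[of _ a] exI[of _ b] conjI disjI1 refl ab b(2))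
    ultimately have "T (isotropic \<i> a) (isotropic \<i> b) v = 0" "T (isotropic \<i> a) (isotropic (- \<i>) b) v = 0"
      using isotropic_root_space[OF a b(1), of \<i> 1] isotropic_root_space[OF a b(1), of "- \<i>" "- 1"]
      by (auto simp: T_def intro: positive_root_kills_v)
    then have 1: "raise (2 * a - 1) (2 * a) (2 * b - 1) v + \<i> *s raise (2 * a - 1) (2 * a) (2 * b) v = 0"
      and 2: "raise (2 * a - 1) (2 * a) (2 * b - 1) v - \<i> *s raise (2 * a - 1) (2 * a) (2 * b) v = 0"
      unfolding isotropic_def[of _ b, abs_def] T_add_right raise by simp_all
    from 2 have 3: "raise (2 * a - 1) (2 * a) (2 * b - 1) v = \<i> *s raise (2 * a - 1) (2 * a) (2 * b) v"
      by simp
    have "(2 * \<i>) *s raise (2 * a - 1) (2 * a) (2 * b) v = 0"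
      using 1 unfolding 3 by (simp only: mult_2 scale_left_distrib)
    with 3 b(3) show ?thesis by auto
  qed
qed

text \<open>For \<open>a > 1\<close> the weight of \<open>v\<close> on the pair
  \<open>2 * a - 1\<close>, \<open>2 * a\<close> is 0. In the sl2 of this pair and a later
  \<open>j\<close>, \<open>v\<close> is then a highest weight vector of weight 0, so
  \<open>lower\<close> kills it as well as \<open>raise\<close>.\<close>

lemma so_stabilizer_kills_v:
  assumes fin: "finite B" "span B = UNIV" and ij: "i \<in> {3..N}" "j \<in> {3..N}"
  shows "T (unit_fun i) (unit_fun j) v = 0"
proof -
  have less: "T (unit_fun i) (unit_fun j) v = 0" if i: "3 \<le> i" and ij: "i < j" "j \<le> N" for i j
  proof -
    \<comment> \<open>\<open>a\<close> numbers the Cartan pair containing the smaller index;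
      \<open>3 \<le> i\<close> excludes the first pair.\<close>
    define a where "a = (i + 1) div 2"
    have "1 < a \<and> a \<le> N div 2 \<and> (i = 2 * a - 1 \<or> i = 2 * a) \<and> 2 * a \<le> j"
      using i ij unfolding a_def by presburger
    then have a: "a \<in> {1..N div 2}" "a \<noteq> 1" and ia: "i = 2 * a - 1 \<or> i = 2 * a" "2 * a \<le> j"
      by auto
    have w: "weight_op (2 * a - 1) (2 * a) v = 0" using weight_v[OF a(1)] a(2) by simp
    show ?thesis
    proof (cases "j = 2 * a")
      case True
      then have "i = 2 * a - 1" using ia ij by auto
      then show ?thesis using w True by (simp add: weight_op_def)
    next
      case False
      then have j: "2 * a < j" using ia by simp
      have r: "raise (2 * a - 1) (2 * a) j v = 0" by (rule raise_v[OF a(1) j ij(2)])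
      have dist: "2 * a - 1 \<in> {1..N}" "2 * a \<in> {1..N}" "j \<in> {1..N}" "2 * a - 1 \<noteq> 2 * a"
        "j \<noteq> 2 * a - 1" "j \<noteq> 2 * a"
        using a(1) j ij(2) by auto
      have "- lower (2 * a - 1) (2 * a) j v = 0"
        by (rule sl2_operators.F_highest_weight_zero[OF sl2[OF dist] w r fin])
      then have l: "lower (2 * a - 1) (2 * a) j v = 0" by simp
      have p: "T (unit_fun (2 * a - 1)) (unit_fun j) v = \<i> *s T (unit_fun (2 * a)) (unit_fun j) v"
        using l by (simp add: lower_def)
      have "(2 * \<i>) *s T (unit_fun (2 * a)) (unit_fun j) v = 0"
        using r unfolding raise_def p by (simp only: mult_2 scale_left_distrib)
      with p ia(1) show ?thesis by auto
    qed
  qed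
  consider "i < j" | "j < i" | "i = j" by linarith
  then show ?thesis
    using less[of i j] less[of j i] ij T_antisym[of "unit_fun j" "unit_fun i" v]
    by cases (auto simp: T_self)
qed

end

end

section \<open>The dimension formula\<close>

context so_representation
begin

lemma dim_highest_weight_module:
  assumes N: "3 \<le> N" and fin: "finite B" "span B = UNIV"
    and irr: "irreducible_lie_representation (so N) s UNIV \<sigma>"
    and v: "so_highest_weight_vector N 0 s \<sigma> (\<lambda>k. of_nat t * so_first_fundamental_weight k) v"
  shows "dim (UNIV :: 'm set) = (\<Sum>k\<le>t. (N - 3 + k) choose k) + (\<Sum>k<t. (N - 3 + k) choose k)"
proof -
  have I: "{1..N} - {1, 2} = {3..N}" by auto
  have one: "1 \<in> {1..N div 2}" using N by auto
  interpret so_weight_module s "{1..N}" "\<lambda>i j. T (unit_fun i) (unit_fun j)" 1 2 t v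
  proof (intro so_weight_module.intro so_weight_module_axioms.intro)
    show "so_operators s {1..N} (\<lambda>i j. T (unit_fun i) (unit_fun j))" by (rule so_operators_axioms)
    show "{1..N} - {1, 2} \<noteq> {}" unfolding I using N by simp
    show "weight_op 1 2 v = of_nat t *s v" using weight_v[OF v one] by simp
    show "raise 1 2 j v = 0" if "j \<in> {1..N} - {1, 2}" for j
      using raise_v[OF v one, of j] that unfolding I by auto
    show "T (unit_fun i) (unit_fun j) v = 0" if "i \<in> {1..N} - {1, 2}" "j \<in> {1..N} - {1, 2}" for i j
      using so_stabilizer_kills_v[OF v fin] that unfolding I by blast
    show "W = {0} \<or> W = UNIV"
      if "subspace W" "\<And>i j w. i \<in> {1..N} \<Longrightarrow> j \<in> {1..N} \<Longrightarrow> w \<in> W \<Longrightarrow> T (unit_fun i) (unit_fun j) w \<in> W" for W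
    proof -
      have "\<forall>X\<in>so N. \<forall>w\<in>W. \<sigma> X w \<in> W" using stable_so[OF that] by blast
      then show ?thesis
        using irr that(1) unfolding irreducible_lie_representation_def by blast
    qed
  qed (use N fin v in \<open>auto simp: so_highest_weight_vector_def\<close>)
  have J: "J = {3..N}" by (simp only: J_def I)
  have "card (multisets_of_size J k) = (N - 3 + k) choose k" for k
  proof -
    have "card J + k - 1 = N - 3 + k" unfolding J using N by simp
    then show ?thesis
      using card_multisets_of_size[OF finite_J J_ne, of k] by simp
  qed
  then show ?thesis using dim_UNIV_eq by simp
qed

end

lemma dim_tensor_product:
  assumes P: "vector_space sP" and Q: "vector_space sQ" and M: "vector_space sM"
    and \<tau>: "is_tensor_product sP P sQ Q sM \<tau>"
  shows "vector_space.dim sM UNIV = vector_space.dim sP P * vector_space.dim sQ Q"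
proof -
  interpret P: vector_space sP by (rule P)
  interpret Q: vector_space sQ by (rule Q)
  interpret M: vector_space sM by (rule M)
  let ?f = "\<lambda>(b, c). \<tau> b c"
  obtain B C where B: "P.independent B" "P.span B = P" and C: "Q.independent C" "Q.span C = Q"
    and inj: "inj_on ?f (B \<times> C)" and BC: "M.independent (?f ` (B \<times> C))" "M.span (?f ` (B \<times> C)) = UNIV"
    using \<tau> unfolding is_tensor_product_def by blast
  have "M.dim UNIV = card (?f ` (B \<times> C))"
    using BC by (intro M.dim_eq_card) simp_all
  also have "\<dots> = card B * card C"
    using inj by (simp add: card_image card_cartesian_product)
  also have "card B = P.dim P"
    using B P.dim_eq_card[of B P] by (metis P.span_span)
  also have "card C = Q.dim Q"
    using C Q.dim_eq_card[of C Q] by (metis Q.span_span)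
  finally show ?thesis .
qed

text \<open>Hockey-stick summation gives C(n+t-1, t) and, for t > 0, C(n+t-2, t-1); the absorption
  identity expresses the second through the first.\<close>

lemma binomial_dimension_identity:
  assumes "n > 2"
  shows "real ((\<Sum>k\<le>t. (n - 2 + k) choose k) + (\<Sum>k<t. (n - 2 + k) choose k)) =
    (real n + 2 * real t - 1) / (real n + real t - 1) * real ((n + t - 1) choose t)"
proof -
  have upto: "(\<Sum>k\<le>t. (n - 2 + k) choose k) = (n + t - 1) choose t" for t
  proof -
    have "Suc (n - 2 + t) = n + t - 1" using assms by simp
    then show ?thesis using sum_choose_lower[of "n - 2" t] by (simp only:)
  qed
  show ?thesis
  proof (cases t)
    case 0
    then show ?thesis using assms by simp
  next
    case (Suc r)
    have Suc_nr: "Suc (n + r - 1) = n + r" using assms by simp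
    have "real (Suc r * ((n + r) choose Suc r)) = real ((n + r) * ((n + r - 1) choose r))"
      using Suc_times_binomial[of r "n + r - 1"] unfolding Suc_nr by (rule arg_cong)
    then have absorb: "(real r + 1) * real ((n + r) choose Suc r) = (real n + real r) * real ((n + r - 1) choose r)"
      by (simp only: of_nat_mult of_nat_add of_nat_Suc add.commute)
    have "{..<t} = {..r}" using Suc by auto
    then have "real ((\<Sum>k\<le>t. (n - 2 + k) choose k) + (\<Sum>k<t. (n - 2 + k) choose k)) =
        real ((n + r) choose Suc r) + real ((n + r - 1) choose r)"
      using upto[of t] upto[of r] by (simp add: Suc)
    also have "\<dots> = (real n + 2 * real r + 1) / (real n + real r) * real ((n + r) choose Suc r)"
      using absorb assms by (simp add: field_simps)
    finally show ?thesis by (simp add: Suc algebra_simps)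
  qed
qed

theorem corollary1p2:
  fixes n t :: nat
    and scaleV :: "complex \<Rightarrow> 'a::ab_group_add \<Rightarrow> 'a"
    and br :: "'a list \<Rightarrow> 'a"
    and e :: "nat \<Rightarrow> 'a"
    and scaleM :: "complex \<Rightarrow> 'm::ab_group_add \<Rightarrow> 'm"
    and \<rho> :: "'a list \<Rightarrow> 'm \<Rightarrow> 'm"
  assumes "n > 2"
    and "vector_products_n_lie_algebra scaleV n br e"
    and "irreducible_n_lie_module scaleV n br scaleM \<rho>"
    and "has_n_lie_highest_weight n e scaleM \<rho> t"
  shows "real (vector_space.dim scaleM (UNIV :: 'm set)) =
    (real n + 2 * real t - 1) / (real n + real t - 1) * real ((n + t - 1) choose t)"
proof -
  obtain B \<sigma> where B: "finite B" "module.span scaleM B = UNIV"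
    and rep: "lie_representation (so (n + 1)) scaleM UNIV \<sigma>"
    and hw: "n > 3 \<Longrightarrow> so_irreducible_highest_weight_module (n + 1) scaleM \<sigma>
        (\<lambda>k. of_nat t * so_first_fundamental_weight k)"
    and so4: "n = 3 \<Longrightarrow> so4_module_Mt_tensor_Mt scaleM \<sigma> t"
    using assms(4) unfolding has_n_lie_highest_weight_def by blast
  have vs: "vector_space scaleM" using rep by (simp add: lie_representation_def)
  show ?thesis
  proof (cases "n = 3")
    case True
    obtain P \<pi> \<tau> where P: "irreducible_lie_representation sl2 fun_scale P \<pi>"
      "vector_space.dim fun_scale P = t + 1" "is_tensor_product fun_scale P fun_scale P scaleM \<tau>"
      using so4[OF True] unfolding so4_module_Mt_tensor_Mt_def by blast
    have "vector_space fun_scale"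
      using P(1) by (simp add: irreducible_lie_representation_def lie_representation_def)
    then have "vector_space.dim scaleM (UNIV :: 'm set) = (t + 1) * (t + 1)"
      using dim_tensor_product[OF _ _ vs P(3)] P(2) by simp
    \<comment> \<open>The claimed value is (2 t + 2) / (t + 2) times this binomial coefficient, that
      is (t + 1)^2.\<close>
    moreover have "real ((t + 2) choose t) = (real t + 2) * (real t + 1) / 2"
    proof -
      have "2 * ((t + 2) choose 2) = (t + 2) * (t + 1)"
        using Suc_times_binomial[of 1 "t + 1"] by (simp add: numeral_2_eq_2)
      then have "real (2 * ((t + 2) choose t)) = real ((t + 2) * (t + 1))"
        using binomial_symmetric[of t "t + 2"] by simp
      then have "2 * real ((t + 2) choose t) = (real t + 2) * (real t + 1)"
        by (simp only: of_nat_mult of_nat_add of_nat_numeral of_nat_1)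
      then show ?thesis by linarith
    qed
    moreover have "n + t - 1 = t + 2" using True by simp
    ultimately show ?thesis using True by (simp add: field_simps)
  next
    case False
    with assms(1) have n: "n > 3" by simp
    interpret so_representation scaleM "n + 1" \<sigma>
      by (intro so_representation.intro so_representation_axioms.intro vs rep)
    obtain v where v: "so_highest_weight_vector (n + 1) 0 scaleM \<sigma>
        (\<lambda>k. of_nat t * so_first_fundamental_weight k) v"
      and irr: "irreducible_lie_representation (so (n + 1)) scaleM UNIV \<sigma>"
      using hw[OF n] unfolding so_irreducible_highest_weight_module_def by blast
    have "n + 1 - 3 = n - 2" using n by simp
    then show ?thesis
      using dim_highest_weight_module[OF _ B irr v] binomial_dimension_identity[OF assms(1), of t] n
      by simp
  qed
qed

end
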